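(* Let $K\subseteq\mathbb{R}^2$ be compact and convex (with nonempty interior) with real-analytic, strictly convex, positively curved boundary. Let $S_0(K)$ be its conic-cluster set and $S(K)$ its sextactic locus. (i) If $\partial K$ is not a conic, then $S_0(K)\subseteq S(K)$; in particular $S_0(K)$ is finite, and any four of its points are in general position (no three collinear). (ii) $S_0(K)$ contains every global extremum (maximum or minimum point) of the affine curvature along $\partial K$, so $S_0(K)\neq\emptyset$. (iii) If $\partial K$ is a conic, then $S_0(K)=\partial K$.
   Context: The conic-cluster set $S_0(K)\subseteq\partial K$ of a compact strictly convex planar body $K$ is the set of extreme points $p$ of $K$ such that every open boundary arc containing $p$ contains six distinct extreme points of $K$ lying on a common conic. The osculating conic of $\partial K$ at $p$ is the unique conic meeting the curve to fifth order at $p$ (contact, i.e. intersection multiplicity, at least $5$); $p$ is sextactic if its osculating conic meets the curve to sixth order there (multiplicity at least $6$). $S(K)$ is the set of sextactic points. Affine curvature: by positive curvature, $\partial K$ has (locally) a real-analytic parametrization $\gamma(s)$ by affine arclength, $\det(\gamma',\gamma'')\equiv1$; then $\gamma'''=-\mu\gamma'$ for a real-analytic function $\mu$, the affine curvature. "Positively curved" means the curvature of the boundary curve is everywhere strictly positive. *)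

theory Defs
  imports "HOL-Analysis.Analysis"
begin

definition strictly_convex :: "(real^2) set \<Rightarrow> bool" where
  "strictly_convex K \<longleftrightarrow> convex K \<and> (\<forall>x\<in>K. \<forall>y\<in>K. x \<noteq> y \<longrightarrow> open_segment x y \<subseteq> interior K)"


subsection \<open>Real-analytic plane curves\<close>

abbreviation vderiv :: "(real \<Rightarrow> real^2) \<Rightarrow> real \<Rightarrow> real^2" where
  "vderiv g \<equiv> (\<lambda>t. vector_derivative g (at t))"

definition real_analytic_on :: "(real \<Rightarrow> real^2) \<Rightarrow> real set \<Rightarrow> bool" where
  "real_analytic_on g I \<longleftrightarrow>
     (\<forall>t\<in>I. \<forall>i. \<exists>F. (\<lambda>h. g (t + h) $ i) has_fps_expansion F)"

text \<open>Regular real-analytic parametrizations, by an open interval, of relatively open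
  pieces of a set \<open>C\<close>. Requiring a homeomorphism onto a relatively open subset makes \<open>C\<close>
  an embedded curve near each point of the image.\<close>

definition analytic_param :: "(real^2) set \<Rightarrow> real set \<Rightarrow> (real \<Rightarrow> real^2) \<Rightarrow> bool" where
  "analytic_param C I g \<longleftrightarrow>
     open I \<and> is_interval I \<and> real_analytic_on g I \<and> (\<forall>t\<in>I. vderiv g t \<noteq> 0) \<and>
     openin (top_of_set C) (g ` I) \<and> (\<exists>h. homeomorphism I (g ` I) g h)"

definition real_analytic_curve :: "(real^2) set \<Rightarrow> bool" where
  "real_analytic_curve C \<longleftrightarrow> (\<forall>p\<in>C. \<exists>I g. analytic_param C I g \<and> p \<in> g ` I)"

text \<open>The absolute value makes the curvature independent of the orientation; it is the usual
  curvature of the boundary of a convex body traversed counterclockwise.\<close>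

definition curvature :: "(real \<Rightarrow> real^2) \<Rightarrow> real \<Rightarrow> real" where
  "curvature g t =
     \<bar>det (vector [vderiv g t, (vderiv ^^ 2) g t] :: real^2^2)\<bar> / norm (vderiv g t) ^ 3"

definition positively_curved :: "(real^2) set \<Rightarrow> bool" where
  "positively_curved C \<longleftrightarrow> (\<forall>I g. analytic_param C I g \<longrightarrow> (\<forall>t\<in>I. curvature g t > 0))"


subsection \<open>Affine curvature\<close>

definition affine_arclength_param :: "(real^2) set \<Rightarrow> real set \<Rightarrow> (real \<Rightarrow> real^2) \<Rightarrow> bool" where
  "affine_arclength_param C I g \<longleftrightarrow> analytic_param C I g \<and>
     (\<forall>s\<in>I. det (vector [vderiv g s, (vderiv ^^ 2) g s] :: real^2^2) = 1)"

text \<open>The normalization \<open>det (g', g'') = 1\<close> determines the parametrization near a given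
  point, orientation included, up to a translation of the parameter, so that \<open>m\<close> below depends
  only on \<open>p\<close>.\<close>

definition affine_curvature :: "(real^2) set \<Rightarrow> real^2 \<Rightarrow> real" where
  "affine_curvature C p = (THE m. \<exists>I g s. affine_arclength_param C I g \<and> s \<in> I \<and> g s = p \<and>
      (vderiv ^^ 3) g s = - m *\<^sub>R vderiv g s)"

definition affine_curvature_global_max :: "(real^2) set \<Rightarrow> real^2 \<Rightarrow> bool" where
  "affine_curvature_global_max C p \<longleftrightarrow>
     p \<in> C \<and> (\<forall>q\<in>C. affine_curvature C q \<le> affine_curvature C p)"

definition affine_curvature_global_min :: "(real^2) set \<Rightarrow> real^2 \<Rightarrow> bool" where
  "affine_curvature_global_min C p \<longleftrightarrow>
     p \<in> C \<and> (\<forall>q\<in>C. affine_curvature C p \<le> affine_curvature C q)"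


subsection \<open>Conics and sextactic points\<close>

definition quadratic_fun :: "(real^2 \<Rightarrow> real) \<Rightarrow> bool" where
  "quadratic_fun F \<longleftrightarrow> (\<exists>a b c d e f. (a, b, c) \<noteq> (0, 0, 0) \<and>
     F = (\<lambda>z. a * (z$1)^2 + b * z$1 * z$2 + c * (z$2)^2 + d * z$1 + e * z$2 + f))"

definition is_conic :: "(real^2) set \<Rightarrow> bool" where
  "is_conic C \<longleftrightarrow> (\<exists>F. quadratic_fun F \<and> C = {z. F z = 0})"

text \<open>The conic \<open>F = 0\<close> has intersection multiplicity at least \<open>k\<close> with the curve \<open>C\<close> at \<open>p\<close>.
  The order of vanishing does not depend on the regular parametrization chosen.\<close>

definition contact_at_least :: "nat \<Rightarrow> (real^2) set \<Rightarrow> real^2 \<Rightarrow> (real^2 \<Rightarrow> real) \<Rightarrow> bool" where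
  "contact_at_least k C p F \<longleftrightarrow> (\<exists>I g t. analytic_param C I g \<and> t \<in> I \<and> g t = p \<and>
     (\<forall>j<k. (deriv ^^ j) (F \<circ> g) t = 0))"

text \<open>A conic determines its equation only up to a scalar factor, which is the sense in which
  the osculating conic is unique.\<close>

definition osculating_conic :: "(real^2) set \<Rightarrow> real^2 \<Rightarrow> (real^2 \<Rightarrow> real) \<Rightarrow> bool" where
  "osculating_conic C p F \<longleftrightarrow> quadratic_fun F \<and> contact_at_least 5 C p F \<and>
     (\<forall>G. quadratic_fun G \<and> contact_at_least 5 C p G \<longrightarrow> (\<exists>c. G = (\<lambda>z. c * F z)))"

definition sextactic :: "(real^2) set \<Rightarrow> real^2 \<Rightarrow> bool" where
  "sextactic C p \<longleftrightarrow> (\<exists>F. osculating_conic C p F \<and> contact_at_least 6 C p F)"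

definition sextactic_locus :: "(real^2) set \<Rightarrow> (real^2) set" where
  "sextactic_locus K = {p \<in> frontier K. sextactic (frontier K) p}"


subsection \<open>The conic-cluster set\<close>

definition open_boundary_arc :: "(real^2) set \<Rightarrow> (real^2) set \<Rightarrow> bool" where
  "open_boundary_arc K A \<longleftrightarrow>
     openin (top_of_set (frontier K)) A \<and> A homeomorphic {0<..<1::real}"

definition conic_cluster_set :: "(real^2) set \<Rightarrow> (real^2) set" where
  "conic_cluster_set K = {p. p extreme_point_of K \<and>
     (\<forall>A. open_boundary_arc K A \<and> p \<in> A \<longrightarrow>
        (\<exists>T. T \<subseteq> A \<and> card T = 6 \<and> (\<forall>q\<in>T. q extreme_point_of K) \<and>
             (\<exists>C. is_conic C \<and> T \<subseteq> C)))}"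

definition general_position :: "(real^2) set \<Rightarrow> bool" where
  "general_position T \<longleftrightarrow> (\<forall>U\<subseteq>T. card U = 3 \<longrightarrow> \<not> collinear U)"

end

theory Submission
  imports Defs "HOL-Complex_Analysis.Complex_Analysis"
begin

text \<open>In the affine frame \<open>g', g''\<close> at \<open>g s\<close>, with coordinates \<open>u, v\<close>, the osculating conic is
  \<open>Q = u\<^sup>2 + \<mu> v\<^sup>2 - 2 v = 0\<close>. Along the curve \<open>Q\<close> vanishes to order five with leading coefficient
  \<open>- \<mu>' / 20\<close>, so sextactic points are the zeros of \<open>\<mu>'\<close>. Conics through six points that cluster at \<open>p\<close>
  converge (Rolle, compactness of the coefficient sphere) to a conic with contact of order six at
  \<open>p\<close>, whence \<open>\<mu>' = 0\<close> there. If the zeros of \<open>\<mu>'\<close> accumulate, then \<open>Q\<close> does not depend on the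
  base point near the limit because \<open>dQ/ds = \<mu>' v\<^sup>2\<close>; the curve is locally a conic, and by analytic
  continuation globally. At an extremum of \<open>\<mu>\<close>, the formula \<open>d/ds (u\<^sup>2 + m v\<^sup>2 - 2 v) = 2 (\<mu> - m) u v\<close>
  shows that the curve stays on one side of its osculating conic, and a small perturbation of \<open>Q\<close>
  then has six sign changes along the curve near the point.\<close>

text \<open>Contact and affine curvature are defined through arbitrary parametrizations. Contact is
  therefore restated on the curve itself (\<open>flat_at\<close>), and
  \<open>affine_curvature\<close> is shown to be single-valued by comparing two osculating conics,
  which must be proportional, instead of two parameters. An affine arclength parameter s of g(t)
  satisfies dt/ds = D^(-1/3) with D = det (g', g''); its analyticity needs an analytic inverse
  function, which is taken from the complex domain. In the cluster argument the limiting coefficient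
  vector is nonzero, but its quadratic part might vanish; this is why uniqueness of the osculating
  conic is proved for all polynomials of degree at most two. The six zeros at an extremum rest on
  even orders of vanishing: 1, v, v^2 have order 0, 2, 4 and Q has order at least five. With Q made
  nonnegative, and unless it vanishes on a whole side, the terms Q, -a v^2, b v, -c dominate in turn
  as the point is approached, each with the same sign on both sides; this gives three sign changes
  on either side.\<close>

no_notation fps_nth (infixl \<open>$\<close> 75)

subsection \<open>Real-analytic functions of one variable\<close>

definition real_analytic_at :: "(real \<Rightarrow> real) \<Rightarrow> real \<Rightarrow> bool" where
  "real_analytic_at f t \<longleftrightarrow> (\<exists>F. (\<lambda>h. f (t + h)) has_fps_expansion F)"

lemma real_fps_nth_eq_higher_deriv:
  fixes f :: "real \<Rightarrow> real"
  assumes "f has_fps_expansion F"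
  shows "fps_nth F n = (deriv ^^ n) f 0 / fact n"
  using assms
proof (induction n arbitrary: f F)
  case 0
  then show ?case using has_fps_expansion_imp_0_eq_fps_nth_0 by fastforce
next
  case (Suc n)
  have "fps_nth (fps_deriv F) n = (deriv ^^ n) (deriv f) 0 / fact n"
    using Suc.IH[OF has_fps_expansion_deriv[OF Suc.prems]] .
  also have "(deriv ^^ n) (deriv f) = (deriv ^^ Suc n) f"
    by (simp add: funpow_swap1)
  finally have "of_nat (Suc n) * fps_nth F (Suc n) = (deriv ^^ Suc n) f 0 / fact n"
    by (simp only: fps_deriv_nth) simp
  then show ?case by (simp add: divide_simps del: of_nat_Suc) (simp add: algebra_simps)
qed

lemma has_fps_expansion_shifted_nth:
  fixes f :: "real \<Rightarrow> real"
  assumes "(\<lambda>h. f (t + h)) has_fps_expansion F"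
  shows "fps_nth F n = (deriv ^^ n) f t / fact n"
  using real_fps_nth_eq_higher_deriv[OF assms, of n] higher_deriv_shift_0[of n f t]
  by (simp add: o_def)

lemma has_fps_expansion_tendsto_quotient:
  fixes f :: "real \<Rightarrow> real"
  assumes F: "f has_fps_expansion F" and z: "\<And>j. j < k \<Longrightarrow> fps_nth F j = 0"
  shows "((\<lambda>h. f h / h ^ k) \<longlongrightarrow> fps_nth F k) (at 0)"
\<comment> \<open>\<open>subdegree 0\<close> is 0, so the zero series cannot be handled through its
  subdegree.\<close>
proof (cases "F = 0")
  case True
  then have "eventually (\<lambda>h. f h = 0) (nhds 0)"
    using F has_fps_expansion_0_iff by blast
  then have "eventually (\<lambda>h. f h = 0) (at 0)"
    by (auto simp: eventually_at_filter elim: eventually_mono)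
  then have "eventually (\<lambda>h. f h / h ^ k = 0) (at 0)"
    by (auto elim: eventually_mono)
  then show ?thesis using True by (simp add: tendsto_eventually)
next
  case False
  have "k \<le> subdegree F" using z False
    by (metis nth_subdegree_nonzero not_le_imp_less)
  from has_fps_expansion_shift[OF F this refl]
  have "isCont (\<lambda>x. if x = 0 then fps_nth F k else f x / x ^ k) 0"
    using has_fps_expansion_imp_continuous by blast
  then have "((\<lambda>x. if x = 0 then fps_nth F k else f x / x ^ k) \<longlongrightarrow> fps_nth F k) (at 0)"
    by (simp add: isCont_def)
  then show ?thesis
    by (rule Lim_transform_eventually) (auto simp: eventually_at_filter)
qed

text \<open>Once the lower coefficients vanish, coefficient j is the limit of f h / h^j, which is
  the given quotient times h^(k - j).\<close>

lemma has_fps_expansion_tendsto_0_iff: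
  fixes f :: "real \<Rightarrow> real"
  assumes F: "f has_fps_expansion F"
  shows "((\<lambda>h. f h / h ^ k) \<longlongrightarrow> 0) (at 0) \<longleftrightarrow> (\<forall>j\<le>k. fps_nth F j = 0)"
proof
  assume "\<forall>j\<le>k. fps_nth F j = 0"
  then show "((\<lambda>h. f h / h ^ k) \<longlongrightarrow> 0) (at 0)"
    using has_fps_expansion_tendsto_quotient[OF F, of k] by simp
next
  assume lim: "((\<lambda>h. f h / h ^ k) \<longlongrightarrow> 0) (at 0)"
  have "fps_nth F j = 0" if "j \<le> k" for j
    using that
  proof (induction j rule: less_induct)
    case (less j)
    have 1: "((\<lambda>h. f h / h ^ j) \<longlongrightarrow> fps_nth F j) (at 0)"
      using less by (intro has_fps_expansion_tendsto_quotient[OF F]) auto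
    have "((\<lambda>h::real. f h / h ^ k * h ^ (k - j)) \<longlongrightarrow> 0 * 0 ^ (k - j)) (at 0)"
      by (intro tendsto_intros lim)
    moreover have "eventually (\<lambda>h. f h / h ^ k * h ^ (k - j) = f h / h ^ j) (at 0)"
      using less.prems by (auto simp: eventually_at_filter power_diff field_simps)
    ultimately have "((\<lambda>h. f h / h ^ j) \<longlongrightarrow> 0 * 0 ^ (k - j)) (at 0)"
      by (rule Lim_transform_eventually)
    then show ?case using 1 by (metis mult_zero_left trivial_limit_at tendsto_unique)
  qed
  then show "\<forall>j\<le>k. fps_nth F j = 0" by blast
qed

text \<open>The leading term of a nonzero series keeps f away from 0 in a punctured
  neighbourhood.\<close>

lemma has_fps_expansion_frequently_0:
  fixes f :: "real \<Rightarrow> real"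
  assumes F: "f has_fps_expansion F" and fr: "frequently (\<lambda>h. f h = 0) (at 0)"
  shows "F = 0"
proof (rule ccontr)
  assume "F \<noteq> 0"
  define k where "k = subdegree F"
  have "((\<lambda>h. f h / h ^ k) \<longlongrightarrow> fps_nth F k) (at 0)"
    by (rule has_fps_expansion_tendsto_quotient[OF F]) (use nth_less_subdegree_zero k_def in blast)
  moreover have "fps_nth F k \<noteq> 0"
    using \<open>F \<noteq> 0\<close> by (simp add: k_def)
  ultimately have "eventually (\<lambda>h. f h / h ^ k \<noteq> 0) (at 0)"
    by (rule tendsto_imp_eventually_ne)
  then have "eventually (\<lambda>h. f h \<noteq> 0) (at 0)" by (auto elim: eventually_mono)
  then show False using fr by (simp add: frequently_def)
qed

text \<open>The identity theorem; it is applied to \<open>deriv mu\<close> and to the equation of a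
  conic along the curve.\<close>

lemma real_analytic_at_frequently_0:
  assumes "real_analytic_at f t" and "frequently (\<lambda>x. f x = 0) (at t)"
  shows "eventually (\<lambda>x. f x = 0) (nhds t)"
proof -
  obtain F where F: "(\<lambda>h. f (t + h)) has_fps_expansion F"
    using assms(1) by (auto simp: real_analytic_at_def)
  have "frequently (\<lambda>h. f (t + h) = 0) (at 0)"
    using assms(2) unfolding frequently_def at_to_0[of t] eventually_filtermap
    by (simp add: add.commute)
  then have "eventually (\<lambda>h. f (t + h) = 0) (nhds 0)"
    using has_fps_expansion_frequently_0[OF F] F has_fps_expansion_0_iff[of "\<lambda>h. f (t + h)"] by metis
  then show ?thesis
    by (subst nhds_to_0) (simp add: eventually_filtermap add.commute)
qed

section \<open>Closure properties and complexification\<close>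

lemma real_analytic_at_const [simp]: "real_analytic_at (\<lambda>x. c) t"
  unfolding real_analytic_at_def using has_fps_expansion_const by blast

lemma real_analytic_at_add:
  "real_analytic_at f t \<Longrightarrow> real_analytic_at g t \<Longrightarrow> real_analytic_at (\<lambda>x. f x + g x) t"
  unfolding real_analytic_at_def using has_fps_expansion_add by blast

lemma real_analytic_at_diff:
  "real_analytic_at f t \<Longrightarrow> real_analytic_at g t \<Longrightarrow> real_analytic_at (\<lambda>x. f x - g x) t"
  unfolding real_analytic_at_def using has_fps_expansion_diff by blast

lemma real_analytic_at_mult:
  "real_analytic_at f t \<Longrightarrow> real_analytic_at g t \<Longrightarrow> real_analytic_at (\<lambda>x. f x * g x) t"
  unfolding real_analytic_at_def using has_fps_expansion_mult by blast

lemma real_analytic_at_power: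
  "real_analytic_at f t \<Longrightarrow> real_analytic_at (\<lambda>x. f x ^ n) t"
  by (induction n) (auto intro: real_analytic_at_mult)

lemmas real_analytic_at_intros = real_analytic_at_const real_analytic_at_add
  real_analytic_at_diff real_analytic_at_mult real_analytic_at_power

lemma real_analytic_at_cong:
  assumes "eventually (\<lambda>x. f x = g x) (nhds t)" "real_analytic_at f t"
  shows "real_analytic_at g t"
proof -
  have "eventually (\<lambda>h. f (t + h) = g (t + h)) (nhds 0)"
    using assms(1) by (subst (asm) nhds_to_0) (simp add: eventually_filtermap add.commute)
  then show ?thesis
    using assms(2) has_fps_expansion_cong[OF _ refl, of "\<lambda>h. f (t + h)" "\<lambda>h. g (t + h)"]
    unfolding real_analytic_at_def by metis
qed

lemma real_analytic_at_deriv: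
  assumes "real_analytic_at f t"
  shows "real_analytic_at (deriv f) t"
proof -
  obtain F where F: "(\<lambda>h. f (t + h)) has_fps_expansion F"
    using assms by (auto simp: real_analytic_at_def)
  have "deriv (\<lambda>h. f (t + h)) h = deriv f (t + h)" for h
    using deriv_shift_0[of f "t + h"] deriv_shift_0[of "\<lambda>h. f (t + h)" h] by (simp add: o_def add.assoc)
  then have "deriv (\<lambda>h. f (t + h)) = (\<lambda>h. deriv f (t + h))" by blast
  then show ?thesis using has_fps_expansion_deriv[OF F] unfolding real_analytic_at_def by auto
qed

lemma real_analytic_at_has_deriv:
  assumes "real_analytic_at f t"
  shows "(f has_field_derivative deriv f t) (at t)"
proof -
  obtain F where F: "(\<lambda>h. f (t + h)) has_fps_expansion F"
    using assms by (auto simp: real_analytic_at_def)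
  have "(eval_fps F has_field_derivative eval_fps (fps_deriv F) 0) (at 0)"
    using F by (intro has_field_derivative_eval_fps) (simp add: has_fps_expansion_def zero_ereal_def)
  moreover have "eventually (\<lambda>h. eval_fps F h = f (t + h)) (nhds 0)"
    using F by (simp add: has_fps_expansion_def)
  ultimately have "((\<lambda>h. f (t + h)) has_field_derivative eval_fps (fps_deriv F) 0) (at 0)"
    using DERIV_cong_ev[of 0 0 "eval_fps F" "\<lambda>h. f (t + h)"] by simp
  then have "((\<lambda>h. f (h + t)) has_field_derivative eval_fps (fps_deriv F) 0) (at 0)"
    by (simp add: add.commute)
  then have "(f has_field_derivative eval_fps (fps_deriv F) 0) (at t)"
    using DERIV_shift[of f _ 0 t] by simp
  then show ?thesis using DERIV_imp_deriv by metis
qed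

lemma real_analytic_at_isCont:
  "real_analytic_at f t \<Longrightarrow> isCont f t"
  using real_analytic_at_has_deriv DERIV_isCont by blast

text \<open>A local holomorphic extension makes the complex theory of composition and of inverse
  functions available.\<close>

lemma real_analytic_at_iff_complex:
  "real_analytic_at f t \<longleftrightarrow>
     (\<exists>g. g analytic_on {of_real t} \<and>
          eventually (\<lambda>x. g (of_real x) = complex_of_real (f x)) (nhds t))"
proof
  assume "real_analytic_at f t"
  then obtain F where F: "(\<lambda>h. f (t + h)) has_fps_expansion F"
    by (auto simp: real_analytic_at_def)
  define G where "G = Abs_fps (\<lambda>n. complex_of_real (fps_nth F n))"
  have rad: "fps_conv_radius G = fps_conv_radius F"
    unfolding fps_conv_radius_def G_def by (subst (1 2) conv_radius_norm [symmetric]) simp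
  have ev: "eval_fps G (of_real h) = of_real (eval_fps F h)" if "norm h < fps_conv_radius F" for h
  proof -
    have "(\<lambda>n. complex_of_real (fps_nth F n * h ^ n)) sums of_real (eval_fps F h)"
      using sums_eval_fps[OF that] sums_of_real by blast
    then show ?thesis by (simp add: eval_fps_def G_def sums_iff)
  qed
  define g where "g = (\<lambda>z. eval_fps G (z - of_real t))"
  have "fps_conv_radius G > 0" using rad F by (simp add: has_fps_expansion_def)
  then have "(\<lambda>h. g (of_real t + h)) has_fps_expansion G"
    using eval_fps_has_fps_expansion by (simp add: g_def)
  then have "g analytic_on {of_real t}" by (rule has_fps_expansion_imp_analytic)
  moreover have "eventually (\<lambda>h. h \<in> eball 0 (fps_conv_radius F)) (nhds 0)"
    using F by (intro eventually_nhds_in_open) (auto simp: has_fps_expansion_def zero_ereal_def)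
  then have "eventually (\<lambda>h. g (of_real (t + h)) = of_real (f (t + h))) (nhds 0)"
    using F unfolding has_fps_expansion_def
    by (auto simp: g_def ev elim!: eventually_elim2)
  then have "eventually (\<lambda>x. g (of_real x) = of_real (f x)) (nhds t)"
    by (subst nhds_to_0) (simp add: eventually_filtermap add.commute)
  ultimately show "\<exists>g. g analytic_on {of_real t} \<and>
          eventually (\<lambda>x. g (of_real x) = complex_of_real (f x)) (nhds t)" by blast
next
  assume "\<exists>g. g analytic_on {of_real t} \<and>
          eventually (\<lambda>x. g (of_real x) = complex_of_real (f x)) (nhds t)"
  then obtain g where g: "g analytic_on {of_real t}"
    "eventually (\<lambda>x. g (of_real x) = complex_of_real (f x)) (nhds t)" by blast
  obtain G where G: "(\<lambda>h. g (of_real t + h)) has_fps_expansion G"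
    using analytic_at_imp_has_fps_expansion[OF g(1)] by blast
  \<comment> \<open>For real h the value of g is real and Re (G_n h^n) = Re G_n h^n, so the real
    parts of the coefficients already expand f.\<close>
  define F where "F = Abs_fps (\<lambda>n. Re (fps_nth G n))"
  have "eventually (\<lambda>z. z \<in> eball 0 (fps_conv_radius G)) (nhds 0)"
    using G by (intro eventually_nhds_in_open) (auto simp: has_fps_expansion_def zero_ereal_def)
  moreover have "eventually (\<lambda>z. eval_fps G z = g (of_real t + z)) (nhds 0)"
    using G by (simp add: has_fps_expansion_def)
  ultimately have "eventually (\<lambda>z. (\<lambda>n. fps_nth G n * z ^ n) sums g (of_real t + z)) (nhds 0)"
  proof eventually_elim
    case (elim z)
    then show ?case using sums_eval_fps[of z G] by simp
  qed
  moreover have "filterlim complex_of_real (nhds 0) (nhds 0)"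
    using tendsto_of_real[OF filterlim_ident[of "nhds (0::real)"]] by simp
  ultimately have e1: "eventually (\<lambda>h::real. (\<lambda>n. fps_nth G n * (of_real h) ^ n) sums g (of_real t + of_real h)) (nhds 0)"
    by (rule eventually_compose_filterlim)
  have e2: "eventually (\<lambda>h. g (of_real (t + h)) = complex_of_real (f (t + h))) (nhds 0)"
    using g(2) by (subst (asm) nhds_to_0) (simp add: eventually_filtermap add.commute)
  have "eventually (\<lambda>h. (\<lambda>n. fps_nth F n * h ^ n) sums f (t + h)) (nhds 0)"
    using e1 e2
  proof eventually_elim
    case (elim h)
    have "(\<lambda>n. Re (fps_nth G n * (of_real h) ^ n)) sums Re (g (of_real t + of_real h))"
      using elim(1) sums_Re by blast
    moreover have "Re (fps_nth G n * (of_real h) ^ n) = fps_nth F n * h ^ n" for n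
      by (simp add: F_def flip: of_real_power)
    ultimately show ?case using elim(2) by (simp only: of_real_add Re_complex_of_real)
  qed
  then show "real_analytic_at f t"
    unfolding real_analytic_at_def by (intro exI[of _ F] has_fps_expansionI)
qed

lemma real_analytic_at_compose:
  assumes f: "real_analytic_at f t" and g: "real_analytic_at g (f t)"
  shows "real_analytic_at (\<lambda>x. g (f x)) t"
proof -
  obtain F where F: "F analytic_on {of_real t}"
    "eventually (\<lambda>x. F (of_real x) = complex_of_real (f x)) (nhds t)"
    using f real_analytic_at_iff_complex by blast
  obtain G where G: "G analytic_on {of_real (f t)}"
    "eventually (\<lambda>x. G (of_real x) = complex_of_real (g x)) (nhds (f t))"
    using g real_analytic_at_iff_complex by blast
  have "F (of_real t) = of_real (f t)" using F(2) eventually_nhds_x_imp_x by blast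
  then have "(\<lambda>z. G (F z)) analytic_on {of_real t}"
    using analytic_on_compose[OF F(1), of G] G(1) by (simp add: o_def)
  moreover have "filterlim f (nhds (f t)) (nhds t)"
    using real_analytic_at_isCont[OF f] by (simp add: isCont_def tendsto_at_iff_tendsto_nhds)
  then have "eventually (\<lambda>x. G (of_real (f x)) = complex_of_real (g (f x))) (nhds t)"
    by (rule eventually_compose_filterlim[OF G(2)])
  with F(2) have "eventually (\<lambda>x. G (F (of_real x)) = complex_of_real (g (f x))) (nhds t)"
    by eventually_elim simp
  ultimately show ?thesis unfolding real_analytic_at_iff_complex by blast
qed

text \<open>The new parameter is a primitive of the real cube root of \<open>D\<close>; analyticity of its inverse
  is inherited from the holomorphic inverse function theorem.\<close>

lemma cube_root_reparametrization:
  assumes D: "real_analytic_at D t" "D t \<noteq> 0" and U: "open U" "t \<in> U"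
  obtains V W s \<tau> where "open V" "t \<in> V" "V \<subseteq> U" "open W" "is_interval W"
    "homeomorphism V W s \<tau>" "\<And>y. y \<in> W \<Longrightarrow> real_analytic_at \<tau> y"
    "\<And>y. y \<in> W \<Longrightarrow> deriv \<tau> y ^ 3 * D (\<tau> y) = 1"
proof -
  obtain G where G: "G analytic_on {of_real t}"
    "eventually (\<lambda>x. G (of_real x) = complex_of_real (D x)) (nhds t)"
    using D(1) real_analytic_at_iff_complex by blast
  \<comment> \<open>The sign moves G into the right half plane near t, where \<open>Ln\<close> is
    holomorphic; since \<sigma>^3 = \<sigma>, it comes back out of the cube.\<close>
  define \<sigma> where "\<sigma> = sgn (D t)"
  have \<sigma>: "\<sigma> * \<sigma> = 1" "\<sigma> * D t > 0"
    using D(2) by (auto simp: \<sigma>_def sgn_real_def)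
  have Gt: "G (of_real t) = of_real (D t)" using G(2) eventually_nhds_x_imp_x by blast
  obtain r0 where r0: "r0 > 0" "G holomorphic_on ball (of_real t) r0"
    using G(1) by (auto simp: analytic_on_def)
  have "isCont G (of_real t)"
    using r0 by (metis centre_in_ball continuous_on_interior holomorphic_on_imp_continuous_on interior_open open_ball)
  then have "isCont (\<lambda>z. \<sigma> * Re (G z)) (of_real t)" 
    unfolding isCont_def by (intro tendsto_intros)
  then have "((\<lambda>z. \<sigma> * Re (G z)) \<longlongrightarrow> \<sigma> * Re (G (of_real t))) (nhds (of_real t))"
    unfolding isCont_def by (subst (asm) tendsto_at_iff_tendsto_nhds)
  then have "eventually (\<lambda>z. \<sigma> * Re (G z) > 0) (nhds (of_real t))"
    using order_tendstoD(1) \<sigma>(2) Gt by fastforce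
  then obtain r1 where r1: "r1 > 0" "\<And>z. dist z (of_real t) < r1 \<Longrightarrow> \<sigma> * Re (G z) > 0"
    by (auto simp: eventually_nhds_metric)
  obtain r2 where r2: "r2 > 0" "\<And>x. dist x t < r2 \<Longrightarrow> G (of_real x) = complex_of_real (D x)"
    using G(2) by (auto simp: eventually_nhds_metric)
  obtain r3 where r3: "r3 > 0" "ball t r3 \<subseteq> U"
    using U open_contains_ball by blast
  define r where "r = Min {r0, r1, r2, r3}"
  have r: "r > 0" "r \<le> r0" "r \<le> r1" "r \<le> r2" "r \<le> r3"
    using r0(1) r1(1) r2(1) r3(1) by (auto simp: r_def)
  let ?B = "ball (complex_of_real t) r"
  \<comment> \<open>The holomorphic cube root of G; on real points it is the real cube root
    \<open>p\<close> of D.\<close>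
  define P where "P = (\<lambda>z. of_real \<sigma> * exp (Ln (of_real \<sigma> * G z) / 3))"
  define p where "p = (\<lambda>x. \<sigma> * exp (ln (\<sigma> * D x) / 3))"
  have npos: "of_real \<sigma> * G z \<notin> \<real>\<^sub>\<le>\<^sub>0" if "z \<in> ?B" for z
  proof -
    have "\<sigma> * Re (G z) > 0" using that r r1(2)[of z] by (auto simp: dist_commute)
    then show ?thesis by (auto simp: complex_nonpos_Reals_iff)
  qed
  have "G holomorphic_on ?B" using r0 r(2) holomorphic_on_subset subset_ball by blast
  then have Phol: "P holomorphic_on ?B"
    unfolding P_def using npos by (intro holomorphic_intros) auto
  have Pne: "P z \<noteq> 0" for z using \<sigma> by (auto simp: P_def)
  have Dpos: "\<sigma> * D x > 0" if "dist x t < r" for x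
    using r1(2)[of "of_real x"] r2(2)[of x] that r by (simp add: dist_of_real)
  have Pp: "P (of_real x) = of_real (p x)" if "dist x t < r" for x
  proof -
    have "P (of_real x) = of_real \<sigma> * exp (Ln (of_real (\<sigma> * D x)) / 3)"
      using r2(2)[of x] that r by (simp add: P_def)
    also have "Ln (of_real (\<sigma> * D x)) = of_real (ln (\<sigma> * D x))"
      using Dpos[OF that] by (rule Ln_of_real)
    finally show ?thesis by (simp add: p_def exp_of_real [symmetric])
  qed
  have p3: "p x ^ 3 = D x" if "dist x t < r" for x
  proof -
    have "p x ^ 3 = \<sigma> ^ 3 * exp (ln (\<sigma> * D x) / 3) ^ 3"
      by (simp add: p_def power_mult_distrib)
    also have "exp (ln (\<sigma> * D x) / 3) ^ 3 = exp (3 * (ln (\<sigma> * D x) / 3))"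
      by (simp flip: exp_of_nat_mult)
    also have "\<dots> = \<sigma> * D x" using Dpos[OF that] by simp
    finally have "p x ^ 3 = (\<sigma> * \<sigma>) * (\<sigma> * \<sigma>) * D x" by (simp add: power3_eq_cube)
    then show ?thesis using \<sigma>(1) by simp
  qed
  obtain S0 where S0: "\<And>z. z \<in> ?B \<Longrightarrow> (S0 has_field_derivative P z) (at z within ?B)"
    using holomorphic_convex_primitive'[OF convex_ball open_ball Phol] by blast
  \<comment> \<open>The constant makes S vanish at t; as the derivative \<open>p\<close> along the
    real line is real, S is then real on V.\<close>
  define S where "S = (\<lambda>z. S0 z - S0 (of_real t))"
  have S: "(S has_field_derivative P z) (at z)" if "z \<in> ?B" for z
  proof -
    have "(S0 has_field_derivative P z) (at z)"
      using S0[OF that] at_within_open[OF that open_ball] by simp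
    then show ?thesis unfolding S_def by (auto intro!: derivative_eq_intros)
  qed
  have Shol: "S holomorphic_on ?B"
    using S holomorphic_on_open[OF open_ball] by blast
  \<comment> \<open>S' = P has no zeros, so S has a holomorphic inverse T near t, whose values at
    real points give \<tau>.\<close>
  have "deriv S (of_real t) \<noteq> 0" using S[of "of_real t"] Pne r(1) DERIV_imp_deriv by fastforce
  then obtain q where q: "q > 0" "ball (of_real t) q \<subseteq> ?B" "inj_on S (ball (of_real t) q)"
    using has_complex_derivative_locally_injective[OF Shol _ open_ball, of "of_real t"] r(1) by auto
  let ?Q = "ball (complex_of_real t) q"
  have qr: "q \<le> r" using q(1,2) by (simp add: ball_subset_ball_iff)
  have Shol': "S holomorphic_on ?Q" using Shol q(2) holomorphic_on_subset by blast
  obtain T where T: "T holomorphic_on (S ` ?Q)" "\<And>z. z \<in> ?Q \<Longrightarrow> T (S z) = z"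
    using holomorphic_has_inverse[OF Shol' open_ball q(3)] by metis
  have opSQ: "open (S ` ?Q)" using open_mapping_thm3[OF Shol' open_ball q(3)] .
  define s where "s = (\<lambda>x. Re (S (of_real x)))"
  define \<tau> where "\<tau> = (\<lambda>y. Re (T (of_real y)))"
  define V where "V = ball t q"
  have inQ: "complex_of_real x \<in> ?Q" if "x \<in> V" for x
    using that by (simp add: V_def dist_of_real)
  have inr: "dist x t < r" if "x \<in> V" for x
    using that qr by (simp add: V_def dist_commute)
  have dS: "((\<lambda>x. S (of_real x)) has_vector_derivative of_real (p x)) (at x)" if "x \<in> V" for x
  proof -
    have "(S has_field_derivative P (of_real x)) (at (of_real x))"
      using S inQ[OF that] q(2) by blast
    then show ?thesis
      using has_vector_derivative_real_field Pp[OF inr[OF that]] by fastforce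
  qed
  have ds: "(s has_field_derivative p x) (at x)" if "x \<in> V" for x
    using bounded_linear.has_vector_derivative[OF bounded_linear_Re dS[OF that]]
    by (simp add: s_def has_real_derivative_iff_has_vector_derivative)
  have dIm: "((\<lambda>x. Im (S (of_real x))) has_field_derivative 0) (at x)" if "x \<in> V" for x
    using bounded_linear.has_vector_derivative[OF bounded_linear_Im dS[OF that]]
    by (simp add: has_real_derivative_iff_has_vector_derivative)
  have tV: "t \<in> V" using q(1) by (simp add: V_def)
  have "Im (S (of_real x)) = 0" if "x \<in> V" for x
  proof -
    have "\<exists>c. \<forall>x\<in>V. Im (S (of_real x)) = c"
      using dIm by (intro has_field_derivative_zero_constant)
        (auto simp: V_def intro: has_field_derivative_at_within)
    then have "Im (S (of_real x)) = Im (S (of_real t))" using tV that by metis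
    then show ?thesis by (simp add: S_def)
  qed
  then have Ss: "S (of_real x) = of_real (s x)" if "x \<in> V" for x
    using that by (simp add: s_def complex_eq_iff)
  have Ts: "T (of_real (s x)) = of_real x" if "x \<in> V" for x
    using T(2)[OF inQ[OF that]] Ss[OF that] by simp
  then have \<tau>s: "\<tau> (s x) = x" if "x \<in> V" for x using that by (simp add: \<tau>_def)
  have cs: "continuous_on V s"
    using ds by (meson DERIV_isCont continuous_at_imp_continuous_on)
  have injs: "inj_on s V" using \<tau>s by (metis inj_on_inverseI)
  define W where "W = s ` V"
  have opW: "open W"
    unfolding W_def using invariance_of_domain[OF cs _ injs] by (simp add: V_def)
  have "connected V" by (simp add: V_def)
  then have "is_interval W"
    unfolding W_def is_interval_connected_1 using cs connected_continuous_image by blast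
  have \<tau>an: "real_analytic_at \<tau> y" if "y \<in> W" for y
  proof -
    have im: "of_real y \<in> S ` ?Q" if "y \<in> W" for y
      using that inQ Ss unfolding W_def by (metis (no_types, lifting) image_iff)
    have "T analytic_on {of_real y}"
      using T(1) im[OF that] opSQ by (metis analytic_at)
    moreover have "eventually (\<lambda>y. y \<in> W) (nhds y)"
      using opW that by (rule eventually_nhds_in_open)
    then have "eventually (\<lambda>y. T (of_real y) = of_real (\<tau> y)) (nhds y)"
      by eventually_elim (auto simp: W_def Ts \<tau>s)
    ultimately show ?thesis unfolding real_analytic_at_iff_complex by blast
  qed
  have c\<tau>: "continuous_on W \<tau>"
    using \<tau>an real_analytic_at_isCont continuous_at_imp_continuous_on by blast
  have "deriv \<tau> y ^ 3 * D (\<tau> y) = 1" if yW: "y \<in> W" for y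
  proof -
    obtain x where x: "x \<in> V" "y = s x" using yW by (auto simp: W_def)
    have "(\<tau> has_field_derivative deriv \<tau> y) (at (s x))"
      using \<tau>an[OF yW] real_analytic_at_has_deriv x by blast
    from DERIV_chain2[OF this ds[OF x(1)]]
    have "((\<lambda>x. \<tau> (s x)) has_field_derivative deriv \<tau> y * p x) (at x)" .
    moreover have "eventually (\<lambda>x. \<tau> (s x) = x) (nhds x)"
      using eventually_nhds_in_open[of V x] x(1) by (auto simp: V_def \<tau>s elim!: eventually_mono)
    then have "((\<lambda>x. \<tau> (s x)) has_field_derivative 1) (at x)"
      using DERIV_cong_ev[of x x "\<lambda>x. \<tau> (s x)" "\<lambda>x. x" 1 1] DERIV_ident by simp
    ultimately have "deriv \<tau> y * p x = 1" using DERIV_unique by blast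
    then have "(deriv \<tau> y * p x) ^ 3 = 1" by simp
    then show ?thesis using p3[OF inr[OF x(1)]] x \<tau>s by (simp add: power_mult_distrib)
  qed
  moreover have "homeomorphism V W s \<tau>"
    using cs c\<tau> \<tau>s by (auto simp: homeomorphism_def W_def image_iff)
  moreover have "V \<subseteq> U" using r3 r(5) qr by (auto simp: V_def)
  moreover have "open V" by (simp add: V_def)
  ultimately show thesis
    using that tV opW \<open>is_interval W\<close> \<tau>an by blast
qed

subsection \<open>Real-analytic plane curves\<close>

definition cross2 :: "real^2 \<Rightarrow> real^2 \<Rightarrow> real" where
  "cross2 a b = a$1 * b$2 - a$2 * b$1"

lemma det_vector_2: "det (vector [a, b] :: real^2^2) = cross2 a b"
  by (simp add: det_2 cross2_def)

lemma real_analytic_on_iff: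
  "real_analytic_on g I \<longleftrightarrow> (\<forall>t\<in>I. \<forall>i. real_analytic_at (\<lambda>x. g x $ i) t)"
  by (simp add: real_analytic_on_def real_analytic_at_def)

lemma vec2_eq_axis: "(v :: real^2) = (v $ 1) *\<^sub>R axis 1 1 + (v $ 2) *\<^sub>R axis 2 1"
  by (simp add: vec_eq_iff forall_2 axis_def)

lemma has_vector_derivative_2I:
  fixes g :: "real \<Rightarrow> real^2"
  assumes "((\<lambda>x. g x $ 1) has_field_derivative d $ 1) (at t)"
    "((\<lambda>x. g x $ 2) has_field_derivative d $ 2) (at t)"
  shows "(g has_vector_derivative d) (at t)"
proof -
  have "((\<lambda>x. (g x $ 1) *\<^sub>R axis 1 1 + (g x $ 2) *\<^sub>R axis 2 (1::real)) has_vector_derivative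
      (d $ 1) *\<^sub>R axis 1 1 + (d $ 2) *\<^sub>R (axis 2 1 :: real^2)) (at t)"
    using assms by (auto intro!: derivative_eq_intros simp: has_real_derivative_iff_has_vector_derivative)
  then show ?thesis by (simp flip: vec2_eq_axis)
qed

lemma real_analytic_on_has_vderiv:
  assumes "real_analytic_on g I" "t \<in> I"
  shows "(g has_vector_derivative vderiv g t) (at t)"
    and "vderiv g t $ i = deriv (\<lambda>x. g x $ i) t"
proof -
  define d where "d = (\<chi> i. deriv (\<lambda>x. g x $ i) t)"
  have "(g has_vector_derivative d) (at t)"
    using assms by (intro has_vector_derivative_2I)
      (auto simp: d_def real_analytic_on_iff intro!: real_analytic_at_has_deriv)
  then show "(g has_vector_derivative vderiv g t) (at t)" "vderiv g t $ i = deriv (\<lambda>x. g x $ i) t"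
    by (simp_all add: vector_derivative_at d_def)
qed

lemma real_analytic_on_vderiv:
  assumes "open I" "real_analytic_on g I"
  shows "real_analytic_on (vderiv g) I"
  unfolding real_analytic_on_iff
proof (intro ballI allI)
  fix t i assume t: "t \<in> I"
  have "eventually (\<lambda>x. x \<in> I) (nhds t)" using assms(1) t by (rule eventually_nhds_in_open)
  then have "eventually (\<lambda>x. deriv (\<lambda>x. g x $ i) x = vderiv g x $ i) (nhds t)"
    by eventually_elim (simp add: real_analytic_on_has_vderiv(2)[OF assms(2)])
  then show "real_analytic_at (\<lambda>x. vderiv g x $ i) t"
    by (rule real_analytic_at_cong)
       (use assms t in \<open>auto simp: real_analytic_on_iff intro: real_analytic_at_deriv\<close>)
qed

lemma real_analytic_on_vderiv_funpow:
  assumes "open I" "real_analytic_on g I"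
  shows "real_analytic_on ((vderiv ^^ n) g) I"
  using assms by (induction n) (auto intro: real_analytic_on_vderiv)

lemma vderiv_funpow_has_vderiv:
  assumes "open I" "real_analytic_on g I" "t \<in> I"
  shows "((vderiv ^^ n) g has_vector_derivative (vderiv ^^ Suc n) g t) (at t)"
  using real_analytic_on_has_vderiv(1)[OF real_analytic_on_vderiv_funpow[OF assms(1,2)] assms(3)]
  by simp

lemma cross2_has_derivative:
  assumes "(a has_vector_derivative a') (at t)" "(b has_vector_derivative b') (at t)"
  shows "((\<lambda>x. cross2 (a x) (b x)) has_real_derivative (cross2 a' (b t) + cross2 (a t) b')) (at t)"
proof -
  have "((\<lambda>x. c x $ i) has_real_derivative c' $ i) (at t)"
    if "(c has_vector_derivative c') (at t)" for c c' and i :: 2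
    using bounded_linear.has_vector_derivative[OF bounded_linear_vec_nth that]
    by (simp add: has_real_derivative_iff_has_vector_derivative)
  note this[OF assms(1)] this[OF assms(2)]
  then show ?thesis
    unfolding cross2_def by (auto intro!: derivative_eq_intros simp: algebra_simps)
qed

lemma real_analytic_at_cross2:
  assumes "\<And>i. real_analytic_at (\<lambda>x. a x $ i) t" "\<And>i. real_analytic_at (\<lambda>x. b x $ i) t"
  shows "real_analytic_at (\<lambda>x. cross2 (a x) (b x)) t"
  unfolding cross2_def by (intro real_analytic_at_diff real_analytic_at_mult assms)

lemma analytic_paramD:
  assumes "analytic_param C I g"
  shows "open I" "is_interval I" "real_analytic_on g I" "\<And>t. t \<in> I \<Longrightarrow> vderiv g t \<noteq> 0"
    "openin (top_of_set C) (g ` I)" "\<exists>h. homeomorphism I (g ` I) g h" "g ` I \<subseteq> C"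
  using assms by (auto simp: analytic_param_def dest: openin_imp_subset)

lemma analytic_param_image_open:
  assumes "analytic_param C I g" "open V" "V \<subseteq> I"
  shows "openin (top_of_set C) (g ` V)"
proof -
  obtain h where h: "homeomorphism I (g ` I) g h" using analytic_paramD(6)[OF assms(1)] by blast
  have "openin (top_of_set I) V" using assms by (metis analytic_paramD(1) openin_open_eq)
  then have "openin (top_of_set (g ` I)) (g ` V)"
    using homeomorphism_imp_open_map[OF h] by blast
  then show ?thesis using analytic_paramD(5)[OF assms(1)] openin_trans by blast
qed

text \<open>The image of g is relatively open in C, so near \<open>g t\<close> the curve has no
  further branch. Punctured neighbourhoods of t and of \<open>g t\<close> in C then correspond under
  g and its inverse, and limits can be moved between them.\<close>

lemma analytic_param_filterlim:
  assumes g: "analytic_param C I g" and t: "t \<in> I"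
  shows "filterlim g (at (g t) within C) (at t)"
    and "\<exists>h. filterlim h (at t) (at (g t) within C) \<and>
             eventually (\<lambda>z. g (h z) = z) (at (g t) within C)"
proof -
  obtain h where h: "homeomorphism I (g ` I) g h" using analytic_paramD(6)[OF g] by blast
  have I: "open I" using analytic_paramD(1)[OF g] .
  have hg: "h (g x) = x" if "x \<in> I" for x using h that by (simp add: homeomorphism_def)
  have gh: "g (h z) = z" "h z \<in> I" if "z \<in> g ` I" for z using h that by (auto simp: homeomorphism_def)
  have ev: "eventually (\<lambda>x. x \<in> I \<and> x \<noteq> t) (at t)"
    using eventually_at_in_open[OF I t] by (simp add: eventually_mono)
  have "isCont g t"
    using h I t by (metis homeomorphism_def continuous_on_eq_continuous_at)
  moreover have "eventually (\<lambda>x. g x \<in> C \<and> g x \<noteq> g t) (at t)"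
    using ev by eventually_elim (use analytic_paramD(7)[OF g] hg t in \<open>metis image_subset_iff\<close>)
  ultimately show "filterlim g (at (g t) within C) (at t)"
    by (auto simp: filterlim_at isCont_def)
  obtain T where T: "open T" "g ` I = C \<inter> T"
    using analytic_paramD(5)[OF g] by (auto simp: openin_open)
  have gtT: "g t \<in> T" using T t by blast
  have at_eq: "at (g t) within C = at (g t) within (g ` I)"
    using at_within_nhd[OF gtT T(1), of C "g ` I"] T(2) by blast
  have "continuous_on (g ` I) h" using h by (simp add: homeomorphism_def)
  then have "(h \<longlongrightarrow> h (g t)) (at (g t) within g ` I)"
    using t by (auto simp: continuous_on_def)
  moreover have "eventually (\<lambda>z. z \<in> g ` I \<and> z \<noteq> g t) (at (g t) within g ` I)"
    by (auto simp: eventually_at_filter)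
  then have "eventually (\<lambda>z. h z \<noteq> t) (at (g t) within g ` I)"
    by eventually_elim (use gh in metis)
  ultimately have "filterlim h (at t) (at (g t) within C)"
    using hg[OF t] by (simp add: filterlim_at at_eq)
  moreover have "eventually (\<lambda>z. g (h z) = z) (at (g t) within C)"
    unfolding at_eq by (auto simp: eventually_at_filter gh)
  ultimately show "\<exists>h. filterlim h (at t) (at (g t) within C) \<and>
             eventually (\<lambda>z. g (h z) = z) (at (g t) within C)" by blast
qed

lemma analytic_param_tendsto_iff:
  assumes "analytic_param C I g" "t \<in> I"
  shows "(f \<longlongrightarrow> l) (at (g t) within C) \<longleftrightarrow> ((\<lambda>x. f (g x)) \<longlongrightarrow> l) (at t)"
proof
  assume "(f \<longlongrightarrow> l) (at (g t) within C)"
  then show "((\<lambda>x. f (g x)) \<longlongrightarrow> l) (at t)"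
    using filterlim_compose analytic_param_filterlim(1)[OF assms] by blast
next
  assume lim: "((\<lambda>x. f (g x)) \<longlongrightarrow> l) (at t)"
  obtain h where h: "filterlim h (at t) (at (g t) within C)"
    "eventually (\<lambda>z. g (h z) = z) (at (g t) within C)"
    using analytic_param_filterlim(2)[OF assms] by blast
  have "((\<lambda>z. f (g (h z))) \<longlongrightarrow> l) (at (g t) within C)"
    using filterlim_compose[OF lim h(1)] .
  then show "(f \<longlongrightarrow> l) (at (g t) within C)"
    by (rule Lim_transform_eventually) (use h(2) in \<open>auto elim: eventually_mono\<close>)
qed

subsection \<open>Order of contact without parametrizations\<close>

text \<open>Contact of order at least \<open>Suc k\<close>, in a form that makes its independence of the
  parametrization evident.\<close>

definition flat_at :: "nat \<Rightarrow> (real^2) set \<Rightarrow> real^2 \<Rightarrow> (real^2 \<Rightarrow> real) \<Rightarrow> bool" where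
  "flat_at k C p F \<longleftrightarrow> ((\<lambda>z. F z / norm (z - p) ^ k) \<longlongrightarrow> 0) (at p within C)"

text \<open>The ratio of \<open>norm (g x - g t)\<close> to |x - t| tends to the nonzero number
  \<open>norm (vderiv g t)\<close>, so their k-th powers are interchangeable in the limit.\<close>

lemma flat_at_param_iff:
  assumes g: "analytic_param C I g" and t: "t \<in> I"
  shows "flat_at k C (g t) F \<longleftrightarrow> ((\<lambda>x. F (g x) / (x - t) ^ k) \<longlongrightarrow> 0) (at t)"
proof -
  have "(g has_vector_derivative vderiv g t) (at t)"
    using real_analytic_on_has_vderiv analytic_paramD(3)[OF g] t by blast
  then have "((\<lambda>x. (g x - g t) /\<^sub>R (x - t)) \<longlongrightarrow> vderiv g t) (at t)"
    using bounded_linear.has_vector_derivative[OF bounded_linear_vec_nth]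
    by (intro vec_tendstoI)
       (fastforce simp: has_real_derivative_iff_has_vector_derivative[symmetric] has_field_derivative_iff divide_inverse_commute)
  then have "((\<lambda>x. norm ((g x - g t) /\<^sub>R (x - t)) ^ k) \<longlongrightarrow> norm (vderiv g t) ^ k) (at t)"
    by (intro tendsto_intros)
  then have n: "((\<lambda>x. norm (g x - g t) ^ k / \<bar>x - t\<bar> ^ k) \<longlongrightarrow> norm (vderiv g t) ^ k) (at t)"
    by (simp add: power_mult_distrib abs_inverse divide_inverse power_inverse mult.commute)
  have nz: "norm (vderiv g t) ^ k \<noteq> 0" using analytic_paramD(4)[OF g t] by simp
  have ne: "eventually (\<lambda>x. x \<noteq> t \<and> g x \<noteq> g t) (at t)"
    using analytic_param_filterlim(1)[OF g t] by (auto simp: filterlim_at eventually_at_filter elim!: eventually_mono)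
  have "flat_at k C (g t) F \<longleftrightarrow> ((\<lambda>x. F (g x) / norm (g x - g t) ^ k) \<longlongrightarrow> 0) (at t)"
    unfolding flat_at_def by (rule analytic_param_tendsto_iff[OF g t])
  also have "\<dots> \<longleftrightarrow> ((\<lambda>x. \<bar>F (g x)\<bar> / \<bar>x - t\<bar> ^ k) \<longlongrightarrow> 0) (at t)"
  proof
    assume "((\<lambda>x. F (g x) / norm (g x - g t) ^ k) \<longlongrightarrow> 0) (at t)"
    then have "((\<lambda>x. \<bar>F (g x) / norm (g x - g t) ^ k\<bar> * (norm (g x - g t) ^ k / \<bar>x - t\<bar> ^ k))
        \<longlongrightarrow> 0 * norm (vderiv g t) ^ k) (at t)"
      by (intro tendsto_mult n tendsto_rabs_zero)
    moreover have "eventually (\<lambda>x. \<bar>F (g x) / norm (g x - g t) ^ k\<bar> * (norm (g x - g t) ^ k / \<bar>x - t\<bar> ^ k)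
        = \<bar>F (g x)\<bar> / \<bar>x - t\<bar> ^ k) (at t)"
      using ne by eventually_elim (simp add: field_simps)
    ultimately show "((\<lambda>x. \<bar>F (g x)\<bar> / \<bar>x - t\<bar> ^ k) \<longlongrightarrow> 0) (at t)"
      by (simp add: Lim_transform_eventually)
  next
    assume "((\<lambda>x. \<bar>F (g x)\<bar> / \<bar>x - t\<bar> ^ k) \<longlongrightarrow> 0) (at t)"
    then have "((\<lambda>x. (\<bar>F (g x)\<bar> / \<bar>x - t\<bar> ^ k) / (norm (g x - g t) ^ k / \<bar>x - t\<bar> ^ k))
        \<longlongrightarrow> 0 / norm (vderiv g t) ^ k) (at t)"
      by (intro tendsto_divide n nz)
    moreover have "eventually (\<lambda>x. (\<bar>F (g x)\<bar> / \<bar>x - t\<bar> ^ k) / (norm (g x - g t) ^ k / \<bar>x - t\<bar> ^ k)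
        = \<bar>F (g x) / norm (g x - g t) ^ k\<bar>) (at t)"
      using ne by eventually_elim (simp add: field_simps)
    ultimately have "((\<lambda>x. \<bar>F (g x) / norm (g x - g t) ^ k\<bar>) \<longlongrightarrow> 0) (at t)"
      by (simp add: Lim_transform_eventually)
    then show "((\<lambda>x. F (g x) / norm (g x - g t) ^ k) \<longlongrightarrow> 0) (at t)"
      using tendsto_rabs_zero_iff by blast
  qed
  also have "\<dots> \<longleftrightarrow> ((\<lambda>x. F (g x) / (x - t) ^ k) \<longlongrightarrow> 0) (at t)"
    using tendsto_rabs_zero_iff[of "\<lambda>x. F (g x) / (x - t) ^ k"] by (simp add: power_abs)
  finally show ?thesis .
qed

text \<open>Convergence to 0, and not mere boundedness, kills the coefficient of order k as well;
  hence \<open>Suc k\<close> vanishing derivatives.\<close>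

lemma real_analytic_flat_iff:
  assumes "real_analytic_at f t"
  shows "((\<lambda>x. f x / (x - t) ^ k) \<longlongrightarrow> 0) (at t) \<longleftrightarrow> (\<forall>j<Suc k. (deriv ^^ j) f t = 0)"
proof -
  obtain F where F: "(\<lambda>h. f (t + h)) has_fps_expansion F"
    using assms by (auto simp: real_analytic_at_def)
  have "((\<lambda>x. f x / (x - t) ^ k) \<longlongrightarrow> 0) (at t) \<longleftrightarrow> ((\<lambda>h. f (t + h) / h ^ k) \<longlongrightarrow> 0) (at 0)"
    by (subst at_to_0) (simp add: filterlim_filtermap add.commute)
  also have "\<dots> \<longleftrightarrow> (\<forall>j\<le>k. fps_nth F j = 0)"
    by (rule has_fps_expansion_tendsto_0_iff[OF F])
  finally show ?thesis by (simp add: has_fps_expansion_shifted_nth[OF F] less_Suc_eq_le)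
qed

text \<open>Unlike \<open>quadratic_fun\<close>, this admits a vanishing quadratic part, so that a
  limit of conics can be handled before it is known not to degenerate.\<close>

definition poly2 :: "(real^2 \<Rightarrow> real) \<Rightarrow> bool" where
  "poly2 F \<longleftrightarrow> (\<exists>a b c d e f.
     F = (\<lambda>z. a * (z$1)^2 + b * z$1 * z$2 + c * (z$2)^2 + d * z$1 + e * z$2 + f))"

lemma quadratic_fun_imp_poly2: "quadratic_fun F \<Longrightarrow> poly2 F"
  unfolding quadratic_fun_def poly2_def by blast

lemma poly2_real_analytic:
  assumes "poly2 F" "\<And>i. real_analytic_at (\<lambda>x. g x $ i) t"
  shows "real_analytic_at (\<lambda>x. F (g x)) t"
proof -
  obtain a b c d e f where
    "F = (\<lambda>z. a * (z$1)^2 + b * z$1 * z$2 + c * (z$2)^2 + d * z$1 + e * z$2 + f)"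
    using assms(1) unfolding poly2_def by blast
  then show ?thesis using assms(2) by (auto intro!: real_analytic_at_intros)
qed

text \<open>The definition of contact picks one parametrization; flatness mentions none, so all of
  them give the same order.\<close>

lemma contact_at_least_iff_flat:
  assumes "poly2 F" and g: "analytic_param C I g" "t \<in> I"
  shows "contact_at_least (Suc k) C (g t) F \<longleftrightarrow> flat_at k C (g t) F"
proof -
  have *: "(\<forall>j<Suc k. (deriv ^^ j) (F \<circ> h) s = 0) \<longleftrightarrow> flat_at k C (h s) F"
    if h: "analytic_param C J h" "s \<in> J" for J h s
  proof -
    have "real_analytic_at (\<lambda>x. F (h x)) s"
      using h analytic_paramD(3)[OF h(1)] by (intro poly2_real_analytic[OF assms(1)]) (auto simp: real_analytic_on_iff)
    from real_analytic_flat_iff[OF this, of k] show ?thesis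
      by (simp add: flat_at_param_iff[OF h] o_def)
  qed
  show ?thesis
    unfolding contact_at_least_def using * g by metis
qed

subsection \<open>Affine arclength\<close>

lemma affine_arclength_paramD:
  assumes "affine_arclength_param C I g"
  shows "analytic_param C I g" "\<And>s. s \<in> I \<Longrightarrow> cross2 (vderiv g s) ((vderiv ^^ 2) g s) = 1"
  using assms by (auto simp: affine_arclength_param_def det_vector_2)

text \<open>For h = g o \<tau> the term with \<tau>'' drops out of det (h', h''), which becomes
  \<tau>'^3 det (g', g''). A real cube root exists for either sign of the determinant; a negative
  one reverses the orientation.\<close>

lemma affine_arclength_param_exists:
  assumes g: "analytic_param C I g" and t: "t \<in> I"
    and curv: "cross2 (vderiv g t) ((vderiv ^^ 2) g t) \<noteq> 0"
  obtains J h s where "affine_arclength_param C J h" "s \<in> J" "h s = g t"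
proof -
  note gI = analytic_paramD[OF g]
  define D where "D = (\<lambda>x. cross2 (vderiv g x) ((vderiv ^^ 2) g x))"
  have gn: "real_analytic_on ((vderiv ^^ n) g) I" for n
    using gI by (intro real_analytic_on_vderiv_funpow)
  have "real_analytic_at D t"
    unfolding D_def using gn[of 1] gn[of 2] t
    by (intro real_analytic_at_cross2) (auto simp: real_analytic_on_iff)
  moreover have "D t \<noteq> 0" using curv by (simp add: D_def)
  ultimately obtain V W s \<tau> where V: "open V" "t \<in> V" "V \<subseteq> I" and W: "open W" "is_interval W"
    and hom: "homeomorphism V W s \<tau>" and \<tau>: "\<And>y. y \<in> W \<Longrightarrow> real_analytic_at \<tau> y"
    and D\<tau>: "\<And>y. y \<in> W \<Longrightarrow> deriv \<tau> y ^ 3 * D (\<tau> y) = 1"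
    using cube_root_reparametrization[of D t I] gI(1) t by blast
  define h where "h = (\<lambda>y. g (\<tau> y))"
  have \<tau>V: "\<tau> y \<in> V" "\<tau> y \<in> I" if "y \<in> W" for y
    using hom V(3) that by (auto simp: homeomorphism_def)
  have h1: "(h has_vector_derivative deriv \<tau> y *\<^sub>R vderiv g (\<tau> y)) (at y)" if y: "y \<in> W" for y
  proof -
    have "(\<tau> has_vector_derivative deriv \<tau> y) (at y)"
      using real_analytic_at_has_deriv[OF \<tau>[OF y]] by (simp add: has_real_derivative_iff_has_vector_derivative)
    moreover have "(g has_vector_derivative vderiv g (\<tau> y)) (at (\<tau> y))"
      using real_analytic_on_has_vderiv(1)[OF gI(3)] \<tau>V(2)[OF y] by blast
    ultimately show ?thesis
      using vector_diff_chain_at[of \<tau> _ y g] unfolding h_def o_def by blast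
  qed
  have vh: "vderiv h y = deriv \<tau> y *\<^sub>R vderiv g (\<tau> y)" if "y \<in> W" for y
    using h1[OF that] by (rule vector_derivative_at)
  have h2: "(vderiv h has_vector_derivative
      deriv (deriv \<tau>) y *\<^sub>R vderiv g (\<tau> y) + (deriv \<tau> y)\<^sup>2 *\<^sub>R (vderiv ^^ 2) g (\<tau> y)) (at y)"
    if y: "y \<in> W" for y
  proof -
    have 1: "(deriv \<tau> has_vector_derivative deriv (deriv \<tau>) y) (at y)"
      using real_analytic_at_has_deriv[OF real_analytic_at_deriv[OF \<tau>[OF y]]]
      by (simp add: has_real_derivative_iff_has_vector_derivative)
    have 2: "(\<tau> has_vector_derivative deriv \<tau> y) (at y)"
      using real_analytic_at_has_deriv[OF \<tau>[OF y]] by (simp add: has_real_derivative_iff_has_vector_derivative)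
    have "(vderiv g has_vector_derivative (vderiv ^^ 2) g (\<tau> y)) (at (\<tau> y))"
      using vderiv_funpow_has_vderiv[OF gI(1,3) \<tau>V(2)[OF y], of 1] by (simp add: numeral_2_eq_2)
    with 2 have "((\<lambda>y. vderiv g (\<tau> y)) has_vector_derivative deriv \<tau> y *\<^sub>R (vderiv ^^ 2) g (\<tau> y)) (at y)"
      using vector_diff_chain_at[of \<tau> _ y "vderiv g"] unfolding o_def by blast
    with 1 have "((\<lambda>y. deriv \<tau> y *\<^sub>R vderiv g (\<tau> y)) has_vector_derivative
      deriv (deriv \<tau>) y *\<^sub>R vderiv g (\<tau> y) + (deriv \<tau> y)\<^sup>2 *\<^sub>R (vderiv ^^ 2) g (\<tau> y)) (at y)"
      by (auto intro!: derivative_eq_intros simp: has_real_derivative_iff_has_vector_derivative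
          power2_eq_square)
    then show ?thesis
      by (rule has_vector_derivative_transform_within_open[OF _ W(1) y]) (simp add: vh)
  qed
  have det1: "cross2 (vderiv h y) ((vderiv ^^ 2) h y) = 1" if y: "y \<in> W" for y
  proof -
    have "(vderiv ^^ 2) h y =
      deriv (deriv \<tau>) y *\<^sub>R vderiv g (\<tau> y) + (deriv \<tau> y)\<^sup>2 *\<^sub>R (vderiv ^^ 2) g (\<tau> y)"
      using vector_derivative_at[OF h2[OF y]] by (simp add: numeral_2_eq_2)
    then have "cross2 (vderiv h y) ((vderiv ^^ 2) h y) = deriv \<tau> y ^ 3 * D (\<tau> y)"
      unfolding vh[OF y] by (simp add: D_def cross2_def power2_eq_square power3_eq_cube algebra_simps)
    then show ?thesis using D\<tau>[OF y] by simp
  qed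
  have "real_analytic_on h W"
    using \<tau> \<tau>V gI(3) unfolding real_analytic_on_iff h_def
    by (auto intro: real_analytic_at_compose)
  moreover have "vderiv h y \<noteq> 0" if "y \<in> W" for y
    using det1[OF that] by (auto simp: cross2_def)
  moreover have him: "h ` W = g ` V"
    using hom by (auto simp: h_def homeomorphism_def image_iff)
  moreover have "openin (top_of_set C) (h ` W)"
    unfolding him using analytic_param_image_open[OF g V(1,3)] .
  moreover have "\<exists>k. homeomorphism W (h ` W) h k"
  proof -
    obtain k where k: "homeomorphism I (g ` I) g k" using gI(6) by blast
    then have "homeomorphism V (g ` V) g k"
      using V(3) by (meson homeomorphism_of_subsets image_mono order_refl homeomorphism_def subset_trans)
    then have "homeomorphism W (g ` V) (g \<circ> \<tau>) (s \<circ> k)"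
      using homeomorphism_compose homeomorphism_symD[OF hom] by blast
    then show ?thesis unfolding him by (auto simp: h_def o_def)
  qed
  ultimately have "affine_arclength_param C W h"
    using W det1 by (simp add: affine_arclength_param_def analytic_param_def det_vector_2)
  moreover have "s t \<in> W" "h (s t) = g t"
    using hom V(2) by (auto simp: h_def homeomorphism_def)
  ultimately show thesis using that by blast
qed

lemma curvature_pos_iff:
  assumes "vderiv g t \<noteq> 0"
  shows "curvature g t > 0 \<longleftrightarrow> cross2 (vderiv g t) ((vderiv ^^ 2) g t) \<noteq> 0"
  using assms by (simp add: curvature_def det_vector_2 zero_less_divide_iff)

lemma positively_curved_affine_arclength:
  assumes "real_analytic_curve C" "positively_curved C" "p \<in> C"
  obtains J h s where "affine_arclength_param C J h" "s \<in> J" "h s = p"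
proof -
  obtain I g t where g: "analytic_param C I g" "t \<in> I" "g t = p"
    using assms(1,3) unfolding real_analytic_curve_def by (metis imageE)
  have "curvature g t > 0" using assms(2) g unfolding positively_curved_def by blast
  then have "cross2 (vderiv g t) ((vderiv ^^ 2) g t) \<noteq> 0"
    using curvature_pos_iff analytic_paramD(4)[OF g(1,2)] by blast
  then show thesis using affine_arclength_param_exists[OF g(1,2)] that g(3) by metis
qed

lemma cross2_basis:
  assumes "cross2 a b = 1"
  shows "w = cross2 w b *\<^sub>R a + cross2 a w *\<^sub>R b"
proof -
  have "w $ i = cross2 a b * w $ i" for i using assms by simp
  moreover have "cross2 a b * w $ i = cross2 w b * a $ i + cross2 a w * b $ i" for i
    using exhaust_2[of i] by (auto simp: cross2_def algebra_simps)
  ultimately show ?thesis by (simp add: vec_eq_iff)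
qed

lemma cross2_simps [simp]:
  "cross2 w w = 0" "cross2 (- a) b = - cross2 a b" "cross2 a (- b) = - cross2 a b"
  "cross2 (c *\<^sub>R a) b = c * cross2 a b" "cross2 a (c *\<^sub>R b) = c * cross2 a b"
  "cross2 (a + d) b = cross2 a b + cross2 d b" "cross2 a (b + d) = cross2 a b + cross2 a d"
  "cross2 (a - d) b = cross2 a b - cross2 d b" "cross2 a (b - d) = cross2 a b - cross2 a d"
  by (simp_all add: cross2_def algebra_simps)

lemma cross2_commute: "cross2 a b = - cross2 b a"
  by (simp add: cross2_def)

text \<open>Coefficient five is the one that separates contact of order six from contact of order
  five.\<close>

lemma fps_mult_nth_small:
  fixes A B :: "'a::comm_ring_1 fps"
  shows "fps_nth (A * B) 0 = fps_nth A 0 * fps_nth B 0"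
    "fps_nth (A * B) 1 = fps_nth A 0 * fps_nth B 1 + fps_nth A 1 * fps_nth B 0"
    "fps_nth (A * B) 2 = fps_nth A 0 * fps_nth B 2 + fps_nth A 1 * fps_nth B 1 + fps_nth A 2 * fps_nth B 0"
    "fps_nth (A * B) 3 = fps_nth A 0 * fps_nth B 3 + fps_nth A 1 * fps_nth B 2 + fps_nth A 2 * fps_nth B 1
      + fps_nth A 3 * fps_nth B 0"
    "fps_nth (A * B) 4 = fps_nth A 0 * fps_nth B 4 + fps_nth A 1 * fps_nth B 3 + fps_nth A 2 * fps_nth B 2
      + fps_nth A 3 * fps_nth B 1 + fps_nth A 4 * fps_nth B 0"
    "fps_nth (A * B) 5 = fps_nth A 0 * fps_nth B 5 + fps_nth A 1 * fps_nth B 4 + fps_nth A 2 * fps_nth B 3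
      + fps_nth A 3 * fps_nth B 2 + fps_nth A 4 * fps_nth B 1 + fps_nth A 5 * fps_nth B 0"
  by (simp_all add: fps_mult_nth eval_nat_numeral sum.atLeast0_atMost_Suc)

subsection \<open>The moving affine frame\<close>

locale affine_arc =
  fixes C :: "(real^2) set" and I :: "real set" and g :: "real \<Rightarrow> real^2"
  assumes param: "affine_arclength_param C I g"
begin

abbreviation g' :: "real \<Rightarrow> real^2" where "g' \<equiv> vderiv g"
abbreviation g'' :: "real \<Rightarrow> real^2" where "g'' \<equiv> (vderiv ^^ 2) g"

text \<open>Once g''' = - \<mu> g' is known, det (g'', g''') = \<mu> det (g', g'') = \<mu>; in this
  form \<mu> is visibly analytic.\<close>

definition mu :: "real \<Rightarrow> real" where
  "mu s = cross2 (g'' s) ((vderiv ^^ 3) g s)"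

text \<open>Cramer's rule: coordinates of \<open>z - g s\<close> in the unimodular frame \<open>g' s, g'' s\<close>.\<close>

definition u :: "real \<Rightarrow> real^2 \<Rightarrow> real" where
  "u s z = cross2 (z - g s) (g'' s)"

definition v :: "real \<Rightarrow> real^2 \<Rightarrow> real" where
  "v s z = cross2 (g' s) (z - g s)"

text \<open>For \<open>m = mu s\<close> this is the equation of the osculating conic at \<open>g s\<close>.\<close>

definition Q :: "real \<Rightarrow> real \<Rightarrow> real^2 \<Rightarrow> real" where
  "Q m s z = (u s z)\<^sup>2 + m * (v s z)\<^sup>2 - 2 * v s z"

lemma aparam: "analytic_param C I g"
  using affine_arclength_paramD(1)[OF param] .

lemmas I_open = analytic_paramD(1)[OF aparam]
lemmas g_analytic = analytic_paramD(3)[OF aparam]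
lemmas image_subset = analytic_paramD(7)[OF aparam]

lemma cross_g'_g'': "s \<in> I \<Longrightarrow> cross2 (g' s) (g'' s) = 1"
  using affine_arclength_paramD(2)[OF param] .

lemma g_funpow_deriv:
  "s \<in> I \<Longrightarrow> ((vderiv ^^ n) g has_vector_derivative (vderiv ^^ Suc n) g s) (at s)"
  using vderiv_funpow_has_vderiv[OF I_open g_analytic] .

lemma g_deriv: "s \<in> I \<Longrightarrow> (g has_vector_derivative g' s) (at s)"
  and g'_deriv: "s \<in> I \<Longrightarrow> (g' has_vector_derivative g'' s) (at s)"
  and g''_deriv: "s \<in> I \<Longrightarrow> (g'' has_vector_derivative (vderiv ^^ 3) g s) (at s)"
  using g_funpow_deriv[of s 0] g_funpow_deriv[of s 1] g_funpow_deriv[of s 2]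
  by (simp_all add: numeral_2_eq_2 numeral_3_eq_3)

text \<open>Differentiate det (g', g'') = 1; the other term is det (g'', g'') = 0.\<close>

lemma cross_g'_g3:
  assumes "s \<in> I"
  shows "cross2 (g' s) ((vderiv ^^ 3) g s) = 0"
proof -
  have "((\<lambda>x. cross2 (g' x) (g'' x)) has_real_derivative
      (cross2 (g'' s) (g'' s) + cross2 (g' s) ((vderiv ^^ 3) g s))) (at s)"
    using cross2_has_derivative[OF g'_deriv g''_deriv] assms by blast
  moreover have "((\<lambda>x. cross2 (g' x) (g'' x)) has_real_derivative 0) (at s)"
    by (rule has_field_derivative_transform_within_open[OF DERIV_const I_open assms])
       (simp add: cross_g'_g'')
  ultimately have "cross2 (g'' s) (g'' s) + cross2 (g' s) ((vderiv ^^ 3) g s) = 0"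
    using DERIV_unique by blast
  then show ?thesis by (simp add: cross2_def)
qed

lemma g3_eq: "s \<in> I \<Longrightarrow> (vderiv ^^ 3) g s = - mu s *\<^sub>R g' s"
  using cross2_basis[OF cross_g'_g'', of s "(vderiv ^^ 3) g s"] cross_g'_g3[of s]
  by (simp add: mu_def cross2_commute[of "(vderiv ^^ 3) g s" "g'' s"])

lemma mu_analytic:
  assumes "s \<in> I" shows "real_analytic_at mu s"
proof -
  have "real_analytic_on ((vderiv ^^ n) g) I" for n
    by (intro real_analytic_on_vderiv_funpow I_open g_analytic)
  then have *: "real_analytic_at (\<lambda>x. (vderiv ^^ n) g x $ i) s" for n i
    using assms by (simp add: real_analytic_on_iff)
  show ?thesis
    unfolding mu_def[abs_def] by (intro real_analytic_at_cross2 *)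
qed

lemma frame_decomposition:
  assumes "s \<in> I"
  shows "z = g s + u s z *\<^sub>R g' s + v s z *\<^sub>R g'' s"
  using cross2_basis[OF cross_g'_g''[OF assms], of "z - g s"]
  unfolding u_def v_def by (simp add: algebra_simps)

lemma u_frame: "s \<in> I \<Longrightarrow> u s (g s + x *\<^sub>R g' s + y *\<^sub>R g'' s) = x"
  and v_frame: "s \<in> I \<Longrightarrow> v s (g s + x *\<^sub>R g' s + y *\<^sub>R g'' s) = y"
proof -
  assume "s \<in> I"
  then have "cross2 (g' s) (g'' s) * x = x" "cross2 (g' s) (g'' s) * y = y"
    by (simp_all add: cross_g'_g'')
  then show "u s (g s + x *\<^sub>R g' s + y *\<^sub>R g'' s) = x" "v s (g s + x *\<^sub>R g' s + y *\<^sub>R g'' s) = y"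
    unfolding u_def v_def cross2_def by (simp_all add: algebra_simps)
qed

text \<open>The point z is fixed and the frame moves: -1 comes from the base point, and g''' = - mu
  g' turns the rest into a multiple of v.\<close>

lemma u_deriv:
  assumes "\<tau> \<in> I"
  shows "((\<lambda>\<tau>. u \<tau> z) has_real_derivative (- 1 + mu \<tau> * v \<tau> z)) (at \<tau>)"
proof -
  have "((\<lambda>\<tau>. z - g \<tau>) has_vector_derivative - g' \<tau>) (at \<tau>)"
    using g_deriv[OF assms] by (auto intro!: derivative_eq_intros)
  from cross2_has_derivative[OF this g''_deriv[OF assms]]
  have "((\<lambda>\<tau>. u \<tau> z) has_real_derivative
     (cross2 (- g' \<tau>) (g'' \<tau>) + cross2 (z - g \<tau>) ((vderiv ^^ 3) g \<tau>))) (at \<tau>)"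
    unfolding u_def .
  also have "cross2 (- g' \<tau>) (g'' \<tau>) + cross2 (z - g \<tau>) ((vderiv ^^ 3) g \<tau>)
      = - cross2 (g' \<tau>) (g'' \<tau>) + mu \<tau> * v \<tau> z"
    unfolding v_def g3_eq[OF assms] by (simp add: cross2_def algebra_simps)
  finally show ?thesis by (simp add: cross_g'_g''[OF assms])
qed

lemma v_deriv:
  assumes "\<tau> \<in> I"
  shows "((\<lambda>\<tau>. v \<tau> z) has_real_derivative (- u \<tau> z)) (at \<tau>)"
proof -
  have "((\<lambda>\<tau>. z - g \<tau>) has_vector_derivative - g' \<tau>) (at \<tau>)"
    using g_deriv[OF assms] by (auto intro!: derivative_eq_intros)
  from cross2_has_derivative[OF g'_deriv[OF assms] this]
  have "((\<lambda>\<tau>. v \<tau> z) has_real_derivative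
     (cross2 (g'' \<tau>) (z - g \<tau>) + cross2 (g' \<tau>) (- g' \<tau>))) (at \<tau>)"
    unfolding v_def .
  also have "cross2 (g'' \<tau>) (z - g \<tau>) + cross2 (g' \<tau>) (- g' \<tau>) = - u \<tau> z"
    unfolding u_def by (simp add: cross2_def algebra_simps)
  finally show ?thesis .
qed

text \<open>With m frozen, the -2 u from u^2 cancels the 2 u from -2 v, and what remains is
  proportional to mu - m. In \<open>Q_mu_deriv\<close> m runs along, and only the derivative of this
  coefficient survives.\<close>

lemma Q_deriv:
  assumes "\<tau> \<in> I"
  shows "((\<lambda>\<tau>. Q m \<tau> z) has_real_derivative (2 * (mu \<tau> - m) * (u \<tau> z * v \<tau> z))) (at \<tau>)"
  unfolding Q_def using u_deriv[OF assms, of z] v_deriv[OF assms, of z]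
  by (auto intro!: derivative_eq_intros simp: algebra_simps power2_eq_square)

lemma Q_mu_deriv:
  assumes "\<tau> \<in> I"
  shows "((\<lambda>\<tau>. Q (mu \<tau>) \<tau> z) has_real_derivative (deriv mu \<tau> * (v \<tau> z)\<^sup>2)) (at \<tau>)"
  unfolding Q_def
  using u_deriv[OF assms, of z] v_deriv[OF assms, of z] real_analytic_at_has_deriv[OF mu_analytic[OF assms]]
  by (auto intro!: derivative_eq_intros simp: algebra_simps power2_eq_square)

lemma u_self [simp]: "u s (g s) = 0" and v_self [simp]: "v s (g s) = 0" and Q_self [simp]: "Q m s (g s) = 0"
  by (simp_all add: u_def v_def Q_def cross2_def)

section \<open>Taylor expansion of the curve in its frame\<close>

lemma higher_deriv_component:
  assumes "s \<in> I"
  shows "(deriv ^^ n) (\<lambda>x. g x $ i) s = (vderiv ^^ n) g s $ i"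
  using assms
proof (induction n arbitrary: s)
  case (Suc n)
  have "eventually (\<lambda>x. x \<in> I) (nhds s)" using I_open Suc.prems by (rule eventually_nhds_in_open)
  then have "eventually (\<lambda>x. (deriv ^^ n) (\<lambda>x. g x $ i) x = (vderiv ^^ n) g x $ i) (nhds s)"
    by eventually_elim (simp add: Suc.IH)
  then have "(deriv ^^ Suc n) (\<lambda>x. g x $ i) s = deriv (\<lambda>x. (vderiv ^^ n) g x $ i) s"
    by (simp add: deriv_cong_ev)
  also have "\<dots> = (vderiv ^^ Suc n) g s $ i"
    using real_analytic_on_has_vderiv(2)[OF real_analytic_on_vderiv_funpow[OF I_open g_analytic] Suc.prems]
    by simp
  finally show ?case .
qed simp

lemma g4_eq:
  assumes "s \<in> I"
  shows "(vderiv ^^ 4) g s = - deriv mu s *\<^sub>R g' s - mu s *\<^sub>R g'' s"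
proof -
  have "((\<lambda>s. - mu s *\<^sub>R g' s) has_vector_derivative (- deriv mu s *\<^sub>R g' s - mu s *\<^sub>R g'' s)) (at s)"
    using real_analytic_at_has_deriv[OF mu_analytic[OF assms]] g'_deriv[OF assms]
    by (auto intro!: derivative_eq_intros simp: has_real_derivative_iff_has_vector_derivative)
  then have "((vderiv ^^ 3) g has_vector_derivative (- deriv mu s *\<^sub>R g' s - mu s *\<^sub>R g'' s)) (at s)"
    by (rule has_vector_derivative_transform_within_open[OF _ I_open assms]) (simp add: g3_eq)
  then show ?thesis by (simp add: vector_derivative_at eval_nat_numeral)
qed

text \<open>Two further derivatives of g''' = - mu g' produce g'' twice with factor -mu'; all other
  terms are multiples of g'.\<close>

lemma cross_g'_g5:
  assumes "s \<in> I"
  shows "cross2 (g' s) ((vderiv ^^ 5) g s) = - 2 * deriv mu s"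
proof -
  have "((\<lambda>s. - deriv mu s *\<^sub>R g' s - mu s *\<^sub>R g'' s) has_vector_derivative
     (- deriv (deriv mu) s *\<^sub>R g' s - deriv mu s *\<^sub>R g'' s - deriv mu s *\<^sub>R g'' s
       - mu s *\<^sub>R (vderiv ^^ 3) g s)) (at s)"
    using real_analytic_at_has_deriv[OF mu_analytic[OF assms]] g'_deriv[OF assms] g''_deriv[OF assms]
      real_analytic_at_has_deriv[OF real_analytic_at_deriv[OF mu_analytic[OF assms]]]
    by (auto intro!: derivative_eq_intros simp: has_real_derivative_iff_has_vector_derivative)
  then have "((vderiv ^^ 4) g has_vector_derivative
     (- deriv (deriv mu) s *\<^sub>R g' s - deriv mu s *\<^sub>R g'' s - deriv mu s *\<^sub>R g'' s
       - mu s *\<^sub>R (vderiv ^^ 3) g s)) (at s)"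
    by (rule has_vector_derivative_transform_within_open[OF _ I_open assms]) (simp add: g4_eq)
  then have "(vderiv ^^ 5) g s = - deriv (deriv mu) s *\<^sub>R g' s - deriv mu s *\<^sub>R g'' s - deriv mu s *\<^sub>R g'' s
       - mu s *\<^sub>R (vderiv ^^ 3) g s" by (simp add: vector_derivative_at eval_nat_numeral)
  also have "cross2 (g' s) \<dots> = - 2 * deriv mu s * cross2 (g' s) (g'' s)"
    unfolding g3_eq[OF assms] by (simp add: cross2_def algebra_simps)
  finally show ?thesis by (simp add: cross_g'_g''[OF assms])
qed

text \<open>The coefficients are the g' and g'' components of the derivatives of g over factorials,
  such as -2 mu' / 5! = - mu' / 60. As U starts at order one, its coefficients up to four determine
  U * U up to order five.\<close>

lemma frame_fps:
  assumes "s \<in> I"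
  obtains U V where "(\<lambda>h. u s (g (s + h))) has_fps_expansion U"
    "(\<lambda>h. v s (g (s + h))) has_fps_expansion V"
    "fps_nth U 0 = 0" "fps_nth U 1 = 1" "fps_nth U 2 = 0" "fps_nth U 3 = - mu s / 6"
    "fps_nth U 4 = - deriv mu s / 24"
    "fps_nth V 0 = 0" "fps_nth V 1 = 0" "fps_nth V 2 = 1 / 2" "fps_nth V 3 = 0"
    "fps_nth V 4 = - mu s / 24" "fps_nth V 5 = - deriv mu s / 60"
proof -
  have "\<exists>F. (\<lambda>h. g (s + h) $ i) has_fps_expansion F" for i
    using g_analytic assms by (simp add: real_analytic_on_def)
  then obtain G where G: "\<And>i. (\<lambda>h. g (s + h) $ i) has_fps_expansion G i" by metis
  have Gn: "fps_nth (G i) n = (vderiv ^^ n) g s $ i / fact n" for i n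
    using has_fps_expansion_shifted_nth[OF G[of i]] higher_deriv_component[OF assms] by simp
  define U where "U = (G 1 - fps_const (g s $ 1)) * fps_const (g'' s $ 2)
    - (G 2 - fps_const (g s $ 2)) * fps_const (g'' s $ 1)"
  define V where "V = fps_const (g' s $ 1) * (G 2 - fps_const (g s $ 2))
    - fps_const (g' s $ 2) * (G 1 - fps_const (g s $ 1))"
  have U: "(\<lambda>h. u s (g (s + h))) has_fps_expansion U"
    unfolding u_def cross2_def U_def vector_minus_component
    by (intro has_fps_expansion_diff has_fps_expansion_mult has_fps_expansion_const G)
  have V: "(\<lambda>h. v s (g (s + h))) has_fps_expansion V"
    unfolding v_def cross2_def V_def vector_minus_component
    by (intro has_fps_expansion_diff has_fps_expansion_mult has_fps_expansion_const G)
  have Un: "fps_nth U n = cross2 ((vderiv ^^ n) g s) (g'' s) / fact n" if "n > 0" for n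
    using that by (simp add: U_def Gn cross2_def diff_divide_distrib)
  have Vn: "fps_nth V n = cross2 (g' s) ((vderiv ^^ n) g s) / fact n" if "n > 0" for n
    using that by (simp add: V_def Gn cross2_def diff_divide_distrib)
  have U0: "fps_nth U 0 = 0" "fps_nth V 0 = 0"
    by (simp_all add: U_def V_def Gn)
  have "fps_nth U 1 = 1" "fps_nth U 2 = 0" "fps_nth U 3 = - mu s / 6" "fps_nth U 4 = - deriv mu s / 24"
    using Un[of 1] Un[of 2] Un[of 3] Un[of 4] assms
    by (simp_all add: cross_g'_g'' g3_eq g4_eq fact_numeral)
  moreover have "fps_nth V 1 = 0" "fps_nth V 2 = 1 / 2" "fps_nth V 3 = 0"
    "fps_nth V 4 = - mu s / 24" "fps_nth V 5 = - deriv mu s / 60"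
    using Vn[of 1] Vn[of 2] Vn[of 3] Vn[of 4] Vn[of 5] assms
    by (simp_all add: cross_g'_g'' cross_g'_g3 cross_g'_g5 g4_eq fact_numeral)
  ultimately show thesis using that U V U0 by blast
qed

lemma shift_tendsto: "((\<lambda>x. f (g x) / (x - s) ^ k) \<longlongrightarrow> l) (at s) \<longleftrightarrow>
    ((\<lambda>h. f (g (s + h)) / h ^ k) \<longlongrightarrow> l) (at 0)"
  by (subst at_to_0) (simp add: filterlim_filtermap add.commute)

lemma v_tendsto:
  assumes "s \<in> I"
  shows "((\<lambda>r. v s (g r) / (r - s) ^ 2) \<longlongrightarrow> 1 / 2) (at s)"
proof -
  obtain U V where V: "(\<lambda>h. v s (g (s + h))) has_fps_expansion V"
    "fps_nth V 0 = 0" "fps_nth V 1 = 0" "fps_nth V 2 = 1 / 2"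
    using frame_fps[OF assms] by metis
  have "((\<lambda>h. v s (g (s + h)) / h ^ 2) \<longlongrightarrow> fps_nth V 2) (at 0)"
    using V by (intro has_fps_expansion_tendsto_quotient[OF V(1)]) (auto simp: less_2_cases_iff)
  then show ?thesis using V(4) shift_tendsto by simp
qed

lemma Q_fps:
  assumes "s \<in> I"
  obtains F where "(\<lambda>h. Q (mu s) s (g (s + h))) has_fps_expansion F"
    "\<And>j. j \<le> 4 \<Longrightarrow> fps_nth F j = 0" "fps_nth F 5 = - deriv mu s / 20"
proof -
  obtain U V where U: "(\<lambda>h. u s (g (s + h))) has_fps_expansion U"
    and V: "(\<lambda>h. v s (g (s + h))) has_fps_expansion V"
    and n: "fps_nth U 0 = 0" "fps_nth U 1 = 1" "fps_nth U 2 = 0" "fps_nth U 3 = - mu s / 6"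
    "fps_nth U 4 = - deriv mu s / 24"
    "fps_nth V 0 = 0" "fps_nth V 1 = 0" "fps_nth V 2 = 1 / 2" "fps_nth V 3 = 0"
    "fps_nth V 4 = - mu s / 24" "fps_nth V 5 = - deriv mu s / 60"
    using frame_fps[OF assms] by blast
  define F where "F = U * U + fps_const (mu s) * (V * V) - fps_const 2 * V"
  have "(\<lambda>h. Q (mu s) s (g (s + h))) has_fps_expansion F"
    unfolding Q_def F_def power2_eq_square
    by (intro has_fps_expansion_diff has_fps_expansion_add has_fps_expansion_mult has_fps_expansion_const U V)
  moreover have "fps_nth F j = 0" if "j \<le> 4" for j
  proof -
    have "fps_nth F 0 = 0" "fps_nth F 1 = 0" "fps_nth F 2 = 0" "fps_nth F 3 = 0" "fps_nth F 4 = 0"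
      unfolding F_def fps_sub_nth fps_add_nth fps_mult_left_const_nth fps_mult_nth_small n
      by simp_all
    moreover have "j = 0 \<or> j = 1 \<or> j = 2 \<or> j = 3 \<or> j = 4" using that by linarith
    ultimately show ?thesis by metis
  qed
  \<comment> \<open>What remains is 2 U1 U4 - 2 V5 = - mu' / 12 + mu' / 30; V * V contributes 2 V2
    V3 = 0.\<close>
  moreover have "fps_nth F 5 = - deriv mu s / 20"
    unfolding F_def fps_sub_nth fps_add_nth fps_mult_left_const_nth fps_mult_nth_small n
    by simp
  ultimately show thesis using that by blast
qed

lemma Q_flat: "s \<in> I \<Longrightarrow> flat_at 4 C (g s) (Q (mu s) s)"
  unfolding flat_at_param_iff[OF aparam] shift_tendsto
  by (rule Q_fps) (auto simp: has_fps_expansion_tendsto_0_iff)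

lemma Q_flat_5_iff: "s \<in> I \<Longrightarrow> flat_at 5 C (g s) (Q (mu s) s) \<longleftrightarrow> deriv mu s = 0"
proof -
  assume s: "s \<in> I"
  obtain F where F: "(\<lambda>h. Q (mu s) s (g (s + h))) has_fps_expansion F"
    "\<And>j. j \<le> 4 \<Longrightarrow> fps_nth F j = 0" "fps_nth F 5 = - deriv mu s / 20"
    using Q_fps[OF s] by blast
  have "(\<forall>j\<le>5. fps_nth F j = 0) \<longleftrightarrow> fps_nth F 5 = 0"
    using F(2) by (metis le_refl le_Suc_eq eval_nat_numeral(3) semiring_norm(26,27))
  then show ?thesis
    unfolding flat_at_param_iff[OF aparam s] shift_tendsto has_fps_expansion_tendsto_0_iff[OF F(1)]
    using F(3) by simp
qed

subsection \<open>Uniqueness of the osculating conic\<close>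

lemma poly2_frame:
  assumes "s \<in> I" "poly2 F"
  obtains c1 c2 c3 c4 c5 c6 where
    "\<And>z. F z = c1 * (u s z)\<^sup>2 + c2 * u s z * v s z + c3 * (v s z)\<^sup>2 + c4 * u s z + c5 * v s z + c6"
proof -
  obtain a b c d e f where F: "F = (\<lambda>z. a * (z$1)^2 + b * z$1 * z$2 + c * (z$2)^2 + d * z$1 + e * z$2 + f)"
    using assms(2) unfolding poly2_def by blast
  have z: "z$i = g s $ i + u s z * g' s $ i + v s z * g'' s $ i" for z i
    using arg_cong[OF frame_decomposition[OF assms(1), of z], of "\<lambda>w. w $ i"] by simp
  obtain p1 p2 q1 q2 r1 r2 where z12: "\<And>z. z$1 = p1 + u s z * q1 + v s z * r1"
    "\<And>z. z$2 = p2 + u s z * q2 + v s z * r2" using z by metis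
  show thesis
  proof (rule that)
    fix z
    show "F z = (a * q1\<^sup>2 + b * q1 * q2 + c * q2\<^sup>2) * (u s z)\<^sup>2
      + (2 * a * q1 * r1 + b * (q1 * r2 + r1 * q2) + 2 * c * q2 * r2) * u s z * v s z
      + (a * r1\<^sup>2 + b * r1 * r2 + c * r2\<^sup>2) * (v s z)\<^sup>2
      + (2 * a * p1 * q1 + b * (p1 * q2 + q1 * p2) + 2 * c * p2 * q2 + d * q1 + e * q2) * u s z
      + (2 * a * p1 * r1 + b * (p1 * r2 + r1 * p2) + 2 * c * p2 * r2 + d * r1 + e * r2) * v s z
      + (a * p1\<^sup>2 + b * p1 * p2 + c * p2\<^sup>2 + d * p1 + e * p2 + f)"
      unfolding F z12[of z] by (simp add: algebra_simps power2_eq_square)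
  qed
qed

lemma frame_poly2: "poly2 (\<lambda>z. c1 * (u s z)\<^sup>2 + c2 * u s z * v s z + c3 * (v s z)\<^sup>2 + c4 * u s z + c5 * v s z + c6)"
proof -
  define a1 where "a1 = g'' s $ 2" define a2 where "a2 = - g'' s $ 1"
  define a0 where "a0 = - cross2 (g s) (g'' s)"
  define b1 where "b1 = - g' s $ 2" define b2 where "b2 = g' s $ 1"
  define b0 where "b0 = - cross2 (g' s) (g s)"
  have uz: "u s z = a1 * z$1 + a2 * z$2 + a0" and vz: "v s z = b1 * z$1 + b2 * z$2 + b0" for z
    by (simp_all add: u_def v_def cross2_def a1_def a2_def a0_def b1_def b2_def b0_def algebra_simps)
  show ?thesis
    unfolding poly2_def uz vz
    apply (rule exI[of _ "c1 * a1\<^sup>2 + c2 * a1 * b1 + c3 * b1\<^sup>2"])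
    apply (rule exI[of _ "2 * c1 * a1 * a2 + c2 * (a1 * b2 + a2 * b1) + 2 * c3 * b1 * b2"])
    apply (rule exI[of _ "c1 * a2\<^sup>2 + c2 * a2 * b2 + c3 * b2\<^sup>2"])
    apply (rule exI[of _ "2 * c1 * a1 * a0 + c2 * (a1 * b0 + a0 * b1) + 2 * c3 * b1 * b0 + c4 * a1 + c5 * b1"])
    apply (rule exI[of _ "2 * c1 * a2 * a0 + c2 * (a2 * b0 + a0 * b2) + 2 * c3 * b2 * b0 + c4 * a2 + c5 * b2"])
    apply (rule exI[of _ "c1 * a0\<^sup>2 + c2 * a0 * b0 + c3 * b0\<^sup>2 + c4 * a0 + c5 * b0 + c6"])
    by (rule ext) (simp add: algebra_simps power2_eq_square)
qed

lemma frame_quadratic: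
  assumes "s \<in> I" "c1 \<noteq> 0"
  shows "quadratic_fun (\<lambda>z. c1 * (u s z)\<^sup>2 + c2 * u s z * v s z + c3 * (v s z)\<^sup>2 + c4 * u s z + c5 * v s z + c6)"
    (is "quadratic_fun ?F")
proof -
  obtain a b c d e f where F: "?F = (\<lambda>z. a * (z$1)^2 + b * z$1 * z$2 + c * (z$2)^2 + d * z$1 + e * z$2 + f)"
    using frame_poly2 unfolding poly2_def by blast
  have "(a, b, c) \<noteq> (0, 0, 0)"
  proof
    assume "(a, b, c) = (0, 0, 0)"
    then have lin: "?F z = d * z$1 + e * z$2 + f" for z using fun_cong[OF F, of z] by simp
    \<comment> \<open>A second difference along the tangent: zero for an affine function, 2 c1 for
      \<open>?F\<close>.\<close>
    have "?F (g s + 1 *\<^sub>R g' s + 0 *\<^sub>R g'' s) + ?F (g s + (-1) *\<^sub>R g' s + 0 *\<^sub>R g'' s)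
      - 2 * ?F (g s + 0 *\<^sub>R g' s + 0 *\<^sub>R g'' s) = 0"
      unfolding lin by (simp add: algebra_simps)
    then show False unfolding u_frame[OF assms(1)] v_frame[OF assms(1)] using assms(2) by simp
  qed
  then show ?thesis unfolding quadratic_fun_def using F by blast
qed

lemma Q_quadratic: "s \<in> I \<Longrightarrow> quadratic_fun (Q m s)"
  using frame_quadratic[of s 1 0 m 0 "-2" 0] by (simp add: Q_def[abs_def] algebra_simps)

text \<open>Five linear equations for six coefficients, triangular in the frame: orders 0 to 4
  settle c6, c4, c5, c2, c3 in turn and leave c1 free.\<close>

lemma flat_4_imp_multiple:
  assumes "s \<in> I" "poly2 F" "flat_at 4 C (g s) F"
  obtains c where "F = (\<lambda>z. c * Q (mu s) s z)"
proof -
  obtain c1 c2 c3 c4 c5 c6 where F: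
    "\<And>z. F z = c1 * (u s z)\<^sup>2 + c2 * u s z * v s z + c3 * (v s z)\<^sup>2 + c4 * u s z + c5 * v s z + c6"
    using poly2_frame[OF assms(1,2)] by blast
  obtain U V where U: "(\<lambda>h. u s (g (s + h))) has_fps_expansion U"
    and V: "(\<lambda>h. v s (g (s + h))) has_fps_expansion V"
    and n: "fps_nth U 0 = 0" "fps_nth U 1 = 1" "fps_nth U 2 = 0" "fps_nth U 3 = - mu s / 6"
    "fps_nth U 4 = - deriv mu s / 24"
    "fps_nth V 0 = 0" "fps_nth V 1 = 0" "fps_nth V 2 = 1 / 2" "fps_nth V 3 = 0"
    "fps_nth V 4 = - mu s / 24" "fps_nth V 5 = - deriv mu s / 60"
    using frame_fps[OF assms(1)] by blast
  define G where "G = fps_const c1 * (U * U) + fps_const c2 * U * V + fps_const c3 * (V * V)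
    + fps_const c4 * U + fps_const c5 * V + fps_const c6"
  have G: "(\<lambda>h. F (g (s + h))) has_fps_expansion G"
    unfolding F G_def power2_eq_square
    by (intro has_fps_expansion_diff has_fps_expansion_add has_fps_expansion_mult has_fps_expansion_const U V)
  have "\<forall>j\<le>4. fps_nth G j = 0"
    using assms(3) unfolding flat_at_param_iff[OF aparam assms(1)] shift_tendsto
      has_fps_expansion_tendsto_0_iff[OF G] .
  then have "fps_nth G 0 = 0" "fps_nth G 1 = 0" "fps_nth G 2 = 0" "fps_nth G 3 = 0" "fps_nth G 4 = 0"
    by auto
  moreover have "fps_nth G 0 = c6" "fps_nth G 1 = c4" "fps_nth G 2 = c1 + c5 / 2"
    "fps_nth G 3 = c2 / 2 - c4 * mu s / 6"
    "fps_nth G 4 = (c3 - c1 * mu s) / 4 - (2 * c1 + c5) * mu s / 24 - c4 * deriv mu s / 24"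
    unfolding G_def mult.assoc fps_sub_nth fps_add_nth fps_mult_left_const_nth fps_mult_nth_small n
    by (simp_all add: field_simps)
  ultimately have "c6 = 0 \<and> c4 = 0 \<and> c5 = -2 * c1 \<and> c2 = 0 \<and> c3 = mu s * c1"
    by (auto simp: field_simps)
  then have "F = (\<lambda>z. c1 * Q (mu s) s z)"
    by (intro ext) (simp add: F Q_def algebra_simps)
  then show thesis by (rule that)
qed

lemma sextactic_iff:
  assumes "s \<in> I"
  shows "sextactic C (g s) \<longleftrightarrow> deriv mu s = 0"
proof -
  let ?Q = "Q (mu s) s"
  have contact: "contact_at_least 5 C (g s) F \<longleftrightarrow> flat_at 4 C (g s) F"
    "contact_at_least 6 C (g s) F \<longleftrightarrow> flat_at 5 C (g s) F" if "poly2 F" for F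
    using contact_at_least_iff_flat[OF that aparam assms, of 4]
      contact_at_least_iff_flat[OF that aparam assms, of 5] by simp_all
  have pQ: "poly2 ?Q" by (rule quadratic_fun_imp_poly2[OF Q_quadratic[OF assms]])
  have osc: "osculating_conic C (g s) ?Q"
    unfolding osculating_conic_def
    using Q_quadratic[OF assms] contact(1)[OF pQ] Q_flat[OF assms]
      contact(1) flat_4_imp_multiple[OF assms] quadratic_fun_imp_poly2 by metis
  show ?thesis
  proof
    assume "deriv mu s = 0"
    then show "sextactic C (g s)"
      unfolding sextactic_def using osc contact(2)[OF pQ] Q_flat_5_iff[OF assms] by blast
  next
    assume "sextactic C (g s)"
    then obtain F where F: "osculating_conic C (g s) F" "contact_at_least 6 C (g s) F"
      unfolding sextactic_def by blast
    have pF: "poly2 F" using F(1) quadratic_fun_imp_poly2 unfolding osculating_conic_def by blast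
    \<comment> \<open>The uniqueness clause is taken from F, so Q is a multiple of F, and flatness
      passes to Q without dividing by c.\<close>
    have "\<exists>c. ?Q = (\<lambda>z. c * F z)"
      using F(1) osc unfolding osculating_conic_def by blast
    then obtain c where c: "?Q = (\<lambda>z. c * F z)" by blast
    have "flat_at 5 C (g s) F" using F(2) contact(2)[OF pF] by blast
    then have "flat_at 5 C (g s) ?Q"
      unfolding flat_at_def c using tendsto_mult_right_zero[of _ _ c] by (fastforce simp: mult.assoc)
    then show "deriv mu s = 0" using Q_flat_5_iff[OF assms] by blast
  qed
qed

end

subsection \<open>Affine curvature is well defined and continuous\<close>

context affine_arc
begin

text \<open>By uniqueness of the osculating conic the two equations at the common point are
  proportional; comparing coefficients in one frame determines the change of frame and hence the
  curvature.\<close>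

lemma mu_unique:
  assumes J: "affine_arc C J h" and s: "s \<in> I" and r: "r \<in> J" and eq: "g s = h r"
  shows "affine_arc.mu h r = mu s"
proof -
  interpret h: affine_arc C J h by (rule J)
  have "poly2 (h.Q (h.mu r) r)" by (rule quadratic_fun_imp_poly2[OF h.Q_quadratic[OF r]])
  moreover have "flat_at 4 C (g s) (h.Q (h.mu r) r)" using h.Q_flat[OF r] eq by simp
  ultimately obtain c where c: "h.Q (h.mu r) r = (\<lambda>z. c * Q (mu s) s z)"
    using flat_4_imp_multiple[OF s] by blast
  \<comment> \<open>The matrix entries of the passage between the two frames.\<close>
  define \<alpha> \<beta> \<gamma> \<delta> where "\<alpha> = cross2 (g' s) (h.g'' r)" and "\<beta> = cross2 (g'' s) (h.g'' r)"
    and "\<gamma> = cross2 (h.g' r) (g' s)" and "\<delta> = cross2 (h.g' r) (g'' s)"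
  have "h.u r (g s + x *\<^sub>R g' s + y *\<^sub>R g'' s) = x * \<alpha> + y * \<beta>"
    "h.v r (g s + x *\<^sub>R g' s + y *\<^sub>R g'' s) = x * \<gamma> + y * \<delta>" for x y
    unfolding h.u_def h.v_def eq[symmetric] \<alpha>_def \<beta>_def \<gamma>_def \<delta>_def
    by (simp_all add: cross2_def algebra_simps)
  then have id: "(x * \<alpha> + y * \<beta>)\<^sup>2 + h.mu r * (x * \<gamma> + y * \<delta>)\<^sup>2 - 2 * (x * \<gamma> + y * \<delta>)
      = c * (x\<^sup>2 + mu s * y\<^sup>2 - 2 * y)" for x y
    using fun_cong[OF c, of "g s + x *\<^sub>R g' s + y *\<^sub>R g'' s"]
    unfolding h.Q_def Q_def u_frame[OF s] v_frame[OF s] by simp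
  \<comment> \<open>Opposite points separate the odd and the even part of the identity.\<close>
  have "\<gamma> = 0"
    using id[of 1 0] id[of "-1" 0] by (simp add: power2_eq_square)
  moreover have "\<delta> = c"
    using id[of 0 1] id[of 0 "-1"] by (simp add: power2_eq_square algebra_simps)
  ultimately have id': "(x * \<alpha> + y * \<beta>)\<^sup>2 + h.mu r * (y * c)\<^sup>2 - 2 * (y * c)
      = c * (x\<^sup>2 + mu s * y\<^sup>2 - 2 * y)" for x y using id[of x y] by simp
  have A: "\<alpha>\<^sup>2 = c" "\<beta>\<^sup>2 + h.mu r * c\<^sup>2 = c * mu s"
    using id'[of 1 0] id'[of 0 1] by (simp_all add: algebra_simps)
  \<comment> \<open>The value at (1, 1), compared with those at (1, 0) and (0, 1), isolates the
    mixed term.\<close>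
  have "(\<alpha> + \<beta>)\<^sup>2 + h.mu r * c\<^sup>2 - 2 * c = c * (1 + mu s - 2)"
    using id'[of 1 1] by simp
  then have "2 * (\<alpha> * \<beta>) = 0"
    using A unfolding power2_sum by (simp only: algebra_simps)
  then have "\<alpha> * \<beta> = 0" by simp
  have "h.g' r = c *\<^sub>R g' s"
    using cross2_basis[OF cross_g'_g''[OF s], of "h.g' r"] \<open>\<gamma> = 0\<close> \<open>\<delta> = c\<close>
      cross2_commute[of "g' s" "h.g' r"] by (simp add: \<gamma>_def \<delta>_def)
  \<comment> \<open>Both frames have determinant +1. With c = \<alpha>^2 this gives \<alpha>^3 = 1,
    so scale and orientation agree.\<close>
  then have "c * \<alpha> = 1" using h.cross_g'_g''[OF r] by (simp add: \<alpha>_def)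
  then have "\<alpha> ^ 3 = 1" using A(1) by (simp add: power3_eq_cube power2_eq_square)
  moreover have "\<alpha> > 0"
  proof (rule ccontr)
    assume "\<not> \<alpha> > 0"
    moreover have "c \<ge> 0" unfolding A(1)[symmetric] by simp
    ultimately have "c * \<alpha> \<le> 0" by (intro mult_nonneg_nonpos) auto
    then show False using \<open>c * \<alpha> = 1\<close> by simp
  qed
  ultimately have "\<alpha> = 1" using power_eq_iff_eq_base[of 3 \<alpha> 1] by simp
  then show ?thesis using A \<open>\<alpha> * \<beta> = 0\<close> \<open>c * \<alpha> = 1\<close> by simp
qed

lemma affine_curvature_eq_mu:
  assumes s: "s \<in> I"
  shows "affine_curvature C (g s) = mu s"
  unfolding affine_curvature_def
proof (rule the_equality)
  show "\<exists>J h r. affine_arclength_param C J h \<and> r \<in> J \<and> h r = g s \<and>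
      (vderiv ^^ 3) h r = - mu s *\<^sub>R vderiv h r"
    using param s g3_eq[OF s] by blast
next
  fix m assume "\<exists>J h r. affine_arclength_param C J h \<and> r \<in> J \<and> h r = g s \<and>
      (vderiv ^^ 3) h r = - m *\<^sub>R vderiv h r"
  then obtain J h r where h: "affine_arclength_param C J h" "r \<in> J" "h r = g s"
    "(vderiv ^^ 3) h r = - m *\<^sub>R vderiv h r" by blast
  interpret h: affine_arc C J h by standard (rule h(1))
  have "h.mu r = m" using h.cross_g'_g''[OF h(2)] cross2_commute[of "h.g'' r" "h.g' r"]
    by (simp add: h.mu_def h(4))
  then show "m = mu s" using mu_unique[OF h.affine_arc_axioms s h(2)] h(3) by simp
qed

lemma affine_curvature_tendsto:
  assumes s: "s \<in> I"
  shows "(affine_curvature C \<longlongrightarrow> affine_curvature C (g s)) (at (g s) within C)"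
  unfolding analytic_param_tendsto_iff[OF aparam s]
proof (rule Lim_transform_eventually)
  show "(mu \<longlongrightarrow> affine_curvature C (g s)) (at s)"
    using real_analytic_at_isCont[OF mu_analytic[OF s]] by (simp add: affine_curvature_eq_mu[OF s] isCont_def)
  have "eventually (\<lambda>x. x \<in> I) (at s)"
    using eventually_at_in_open'[OF I_open s] .
  then show "eventually (\<lambda>x. mu x = affine_curvature C (g x)) (at s)"
    by eventually_elim (simp add: affine_curvature_eq_mu)
qed

end

text \<open>On the compact boundary this provides a maximum point, and thereby a cluster
  point.\<close>

lemma continuous_on_affine_curvature:
  assumes "real_analytic_curve C" "positively_curved C"
  shows "continuous_on C (affine_curvature C)"
  unfolding continuous_on_def
proof
  fix p assume "p \<in> C"
  then obtain J h s where h: "affine_arclength_param C J h" "s \<in> J" "h s = p"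
    using positively_curved_affine_arclength[OF assms] by blast
  interpret affine_arc C J h by standard (rule h(1))
  show "(affine_curvature C \<longlongrightarrow> affine_curvature C p) (at p within C)"
    using affine_curvature_tendsto[OF h(2)] h(3) by simp
qed

subsection \<open>Limits of conics through six points\<close>

text \<open>Split off the largest zero: induction puts its zeros of f' strictly between
  \<open>Min S\<close> and \<open>Max S\<close>, so the one found beyond \<open>Max S\<close> is
  new.\<close>

lemma Rolle_zeros:
  fixes f f' :: "real \<Rightarrow> real"
  assumes "\<And>x. x \<in> J \<Longrightarrow> (f has_real_derivative f' x) (at x)" and J: "is_interval J"
  shows "\<lbrakk>finite T; T \<subseteq> J; card T = Suc n; \<And>x. x \<in> T \<Longrightarrow> f x = 0\<rbrakk> \<Longrightarrow>
    \<exists>T'. finite T' \<and> T' \<subseteq> {Min T<..<Max T} \<and> card T' = n \<and> (\<forall>x\<in>T'. f' x = 0)"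
proof (induction n arbitrary: T)
  case 0
  then show ?case by (intro exI[of _ "{}"]) auto
next
  case (Suc n)
  define m where "m = Max T"
  define S where "S = T - {m}"
  have Tne: "T \<noteq> {}" using Suc.prems by auto
  have mT: "m \<in> T" using Suc.prems Tne by (simp add: m_def)
  have S: "finite S" "S \<subseteq> J" "card S = Suc n" "\<And>x. x \<in> S \<Longrightarrow> f x = 0"
    using Suc.prems mT by (auto simp: S_def)
  have Sne: "S \<noteq> {}" using S(3) by auto
  obtain S' where S': "finite S'" "S' \<subseteq> {Min S<..<Max S}" "card S' = n" "\<forall>x\<in>S'. f' x = 0"
    using Suc.IH[OF S] by blast
  have MS: "Max S \<in> S" using S(1) Sne by simp
  have lt: "Max S < m"
    using MS Suc.prems(1) by (metis DiffE Max_ge S_def m_def insertI1 order_le_imp_less_or_eq)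
  have inJ: "x \<in> J" if "Max S \<le> x" "x \<le> m" for x
    using that J MS S(2) mT Suc.prems(2) unfolding is_interval_1 by blast
  have "\<exists>z>Max S. z < m \<and> (f has_real_derivative 0) (at z)"
  proof (rule Rolle[OF lt])
    show "f (Max S) = f m" using S(4)[OF MS] Suc.prems(4)[OF mT] by simp
    show "continuous_on {Max S..m} f"
      using DERIV_isCont[OF assms(1)[OF inJ]] by (intro continuous_at_imp_continuous_on) auto
    show "f differentiable (at x)" if "Max S < x" "x < m" for x
      using assms(1) inJ that by (meson less_imp_le real_differentiable_def)
  qed
  then obtain z where z: "Max S < z" "z < m" "(f has_real_derivative 0) (at z)" by blast
  have "f' z = 0" using DERIV_unique assms(1) inJ z by (meson less_imp_le)
  moreover have "z \<notin> S'" using S'(2) z(1) by auto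
  moreover have "Min T \<le> Min S" using Sne Suc.prems(1) by (simp add: S_def Min_antimono)
  moreover have "Min S \<le> Max S" using S(1) Sne by simp
  ultimately show ?case
    using S' z lt by (intro exI[of _ "insert z S'"]) (fastforce simp: m_def[symmetric])
qed

lemma Rolle_iterated:
  fixes f :: "nat \<Rightarrow> real \<Rightarrow> real"
  assumes J: "is_interval J"
  shows "\<lbrakk>\<And>j x. x \<in> J \<Longrightarrow> (f j has_real_derivative f (Suc j) x) (at x);
     finite T; T \<subseteq> J; card T = Suc n; \<And>x. x \<in> T \<Longrightarrow> f 0 x = 0\<rbrakk> \<Longrightarrow> \<exists>x\<in>J. f n x = 0"
proof (induction n arbitrary: T f)
  case 0
  then show ?case by (metis card_1_singletonE One_nat_def insert_subset insertI1)
next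
  case (Suc n)
  obtain T' where T': "finite T'" "T' \<subseteq> {Min T<..<Max T}" "card T' = Suc n" "\<forall>x\<in>T'. f (Suc 0) x = 0"
    using Rolle_zeros[of J "f 0" "f (Suc 0)", OF Suc.prems(1) J Suc.prems(2-5)] by blast
  have "T \<noteq> {}" using Suc.prems(4) by auto
  then have "Min T \<in> J" "Max T \<in> J"
    using subsetD[OF Suc.prems(3) Min_in[OF Suc.prems(2)]] subsetD[OF Suc.prems(3) Max_in[OF Suc.prems(2)]]
    by simp_all
  then have "T' \<subseteq> J"
    using J T'(2) unfolding is_interval_1 by (meson greaterThanLessThan_iff less_imp_le subset_eq)
  then show ?case
    using Suc.IH[of "\<lambda>j. f (Suc j)" T'] Suc.prems(1) T' by blast
qed

text \<open>Here \<Phi> stands for a curve of monomials with its derivatives and a for the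
  coefficients of a conic. Rolle gives a different zero for each order j, but all of them tend to
  s.\<close>

lemma limit_of_annihilators:
  fixes \<Phi> :: "nat \<Rightarrow> real \<Rightarrow> 'a::euclidean_space"
  assumes I: "open I" "s \<in> I"
    and \<Phi>: "\<And>j x. x \<in> I \<Longrightarrow> (\<Phi> j has_vector_derivative \<Phi> (Suc j) x) (at x)"
    and zeros: "\<And>\<epsilon>. \<epsilon> > 0 \<Longrightarrow> \<exists>a T. a \<noteq> 0 \<and> T \<subseteq> ball s \<epsilon> \<and> finite T \<and> card T = Suc n \<and>
      (\<forall>x\<in>T. a \<bullet> \<Phi> 0 x = 0)"
  shows "\<exists>a. a \<noteq> 0 \<and> (\<forall>j\<le>n. a \<bullet> \<Phi> j s = 0)"
proof -
  obtain r where r: "r > 0" "ball s r \<subseteq> I" using I open_contains_ball by blast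
  have "\<exists>a x. norm a = 1 \<and> (\<forall>j\<le>n. x j \<in> ball s (r / Suc m) \<and> a \<bullet> \<Phi> j (x j) = 0)" for m
  proof -
    have "r / Suc m > 0" using r by simp
    from zeros[OF this] obtain a T where aT: "a \<noteq> 0" "T \<subseteq> ball s (r / Suc m)" "finite T" "card T = Suc n"
      "\<forall>x\<in>T. a \<bullet> \<Phi> 0 x = 0" by blast
    have sub: "ball s (r / Suc m) \<subseteq> I"
      using r by (intro order.trans[OF subset_ball r(2)]) (simp add: divide_le_eq mult_le_cancel_left1)
    have "\<exists>x\<in>ball s (r / Suc m). a \<bullet> \<Phi> j x = 0" if j: "j \<le> n" for j
    proof -
      \<comment> \<open>Applying Rolle j times to \<open>Suc j\<close> zeros leaves one.\<close>
      obtain T' where T': "T' \<subseteq> T" "card T' = Suc j" "finite T'"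
        using obtain_subset_with_card_n[of "Suc j" T] aT(4) j by auto
      show ?thesis
      proof (rule Rolle_iterated[where f = "\<lambda>j x. a \<bullet> \<Phi> j x" and T = T'])
        show "((\<lambda>x. a \<bullet> \<Phi> j x) has_real_derivative a \<bullet> \<Phi> (Suc j) x) (at x)"
          if "x \<in> ball s (r / Suc m)" for j x
          using bounded_linear.has_vector_derivative[OF bounded_linear_inner_right \<Phi>] that sub
          by (auto simp: has_real_derivative_iff_has_vector_derivative)
      qed (use T' aT is_interval_ball_real in auto)
    qed
    then obtain x where "\<forall>j\<le>n. x j \<in> ball s (r / Suc m) \<and> a \<bullet> \<Phi> j (x j) = 0" by metis
    \<comment> \<open>Scaling to norm one keeps the limit vector away from 0.\<close>
    then show ?thesis
      using aT(1) by (intro exI[of _ "a /\<^sub>R norm a"] exI[of _ x]) simp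
  qed
  then obtain a x where a: "\<And>m. norm (a m) = 1"
    and x: "\<And>m j. j \<le> n \<Longrightarrow> x m j \<in> ball s (r / Suc m)" "\<And>m j. j \<le> n \<Longrightarrow> a m \<bullet> \<Phi> j (x m j) = 0"
    by metis
  obtain l k where l: "l \<in> sphere 0 1" "strict_mono k" "(a \<circ> k) \<longlonglongrightarrow> l"
    using compact_sphere[of "0::'a" 1] a unfolding compact_def by (metis dist_0_norm mem_sphere)
  have "l \<bullet> \<Phi> j s = 0" if j: "j \<le> n" for j
  proof -
    have "(\<lambda>m. r * inverse (real (Suc m))) \<longlonglongrightarrow> r * 0"
      by (intro tendsto_intros LIMSEQ_inverse_real_of_nat)
    then have "(\<lambda>m. r / real (Suc m)) \<longlonglongrightarrow> 0" by (simp add: divide_inverse)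
    then have "(\<lambda>m. x m j) \<longlonglongrightarrow> s"
      by (rule metric_tendsto_imp_tendsto)
         (use x(1)[OF j] r(1) in \<open>auto intro!: always_eventually simp: dist_commute less_imp_le\<close>)
    then have "(\<lambda>m. x (k m) j) \<longlonglongrightarrow> s"
      using LIMSEQ_subseq_LIMSEQ[OF _ l(2)] by (fastforce simp: o_def)
    moreover have "isCont (\<Phi> j) s"
      using \<Phi>[OF I(2)] has_vector_derivative_continuous by blast
    ultimately have "(\<lambda>m. \<Phi> j (x (k m) j)) \<longlonglongrightarrow> \<Phi> j s"
      by (rule isCont_tendsto_compose[rotated])
    then have "(\<lambda>m. (a \<circ> k) m \<bullet> \<Phi> j (x (k m) j)) \<longlonglongrightarrow> l \<bullet> \<Phi> j s"
      using l(3) by (intro tendsto_inner)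
    then show ?thesis using x(2)[OF j] by (simp add: LIMSEQ_const_iff)
  qed
  moreover have "l \<noteq> 0" using l(1) by auto
  ultimately show ?thesis by blast
qed

lemma higher_deriv_unique:
  fixes f :: "nat \<Rightarrow> real \<Rightarrow> real"
  assumes "open I" "\<And>j x. x \<in> I \<Longrightarrow> (f j has_real_derivative f (Suc j) x) (at x)"
  shows "x \<in> I \<Longrightarrow> (deriv ^^ j) (f 0) x = f j x"
proof (induction j arbitrary: x)
  case (Suc j)
  have "eventually (\<lambda>x. x \<in> I) (nhds x)" using assms(1) Suc.prems by (rule eventually_nhds_in_open)
  then have "eventually (\<lambda>x. (deriv ^^ j) (f 0) x = f j x) (nhds x)"
    by eventually_elim (rule Suc.IH)
  then have "(deriv ^^ Suc j) (f 0) x = deriv (f j) x"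
    by (simp add: deriv_cong_ev)
  then show ?case using DERIV_imp_deriv[OF assms(2)[OF Suc.prems]] by simp
qed simp

text \<open>The points 0, +-e1, +-e2 and e1 + e2 separate the six coefficients.\<close>

lemma poly2_coeffs_0:
  assumes "\<And>z::real^2. a * (z$1)^2 + b * z$1 * z$2 + c * (z$2)^2 + d * z$1 + e * z$2 + f = 0"
  shows "a = 0 \<and> b = 0 \<and> c = 0 \<and> d = 0 \<and> e = 0 \<and> f = 0"
  using assms[of "vector [0, 0]"] assms[of "vector [1, 0]"] assms[of "vector [-1, 0]"]
    assms[of "vector [0, 1]"] assms[of "vector [0, -1]"] assms[of "vector [1, 1]"]
  by simp

text \<open>The Veronese map: a polynomial of degree at most two is an inner product with its
  coefficient vector, and such vectors form a Euclidean space with compact unit sphere.\<close>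

definition monomials2 :: "real^2 \<Rightarrow> real \<times> real \<times> real \<times> real \<times> real \<times> real" where
  "monomials2 z = ((z$1)^2, z$1 * z$2, (z$2)^2, z$1, z$2, 1)"

context affine_arc
begin

text \<open>The limit polynomial is nonzero and has contact six. Contact five already makes it a
  nonzero multiple of Q, so it cannot have degenerated, for instance to a line.\<close>

lemma six_zeros_imp_deriv_mu:
  assumes s: "s \<in> I"
    and zeros: "\<And>\<epsilon>. \<epsilon> > 0 \<Longrightarrow> \<exists>F T. quadratic_fun F \<and> T \<subseteq> ball s \<epsilon> \<and> card T = 6 \<and> (\<forall>x\<in>T. F (g x) = 0)"
  shows "deriv mu s = 0"
proof -
  \<comment> \<open>Outside the indices 0 to 5 the operator \<open>!\<close> is unspecified, whence
    the condition i < 6 below.\<close>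
  define m where "m = (\<lambda>i x. [(g x $ 1)^2, g x $ 1 * g x $ 2, (g x $ 2)^2, g x $ 1, g x $ 2, 1] ! i)"
  have m: "real_analytic_at (m i) x" if "x \<in> I" "i < 6" for i x
  proof -
    have "real_analytic_at (\<lambda>x. g x $ i) x" for i
      using g_analytic that(1) by (simp add: real_analytic_on_iff)
    moreover have "i = 0 \<or> i = 1 \<or> i = 2 \<or> i = 3 \<or> i = 4 \<or> i = 5" using that(2) by linarith
    ultimately show ?thesis
      by (auto simp: m_def eval_nat_numeral intro!: real_analytic_at_intros)
  qed
  have mj: "real_analytic_at ((deriv ^^ j) (m i)) x" if "x \<in> I" "i < 6" for i j x
    using m[OF that] by (induction j) (auto intro: real_analytic_at_deriv)
  define \<Phi> where "\<Phi> = (\<lambda>j x. ((deriv ^^ j) (m 0) x, (deriv ^^ j) (m 1) x, (deriv ^^ j) (m 2) x,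
     (deriv ^^ j) (m 3) x, (deriv ^^ j) (m 4) x, (deriv ^^ j) (m 5) x))"
  have \<Phi>d: "(\<Phi> j has_vector_derivative \<Phi> (Suc j) x) (at x)" if "x \<in> I" for j x
  proof -
    have "((deriv ^^ j) (m i) has_vector_derivative (deriv ^^ Suc j) (m i) x) (at x)" if "i < 6" for i
      using real_analytic_at_has_deriv[OF mj[OF \<open>x \<in> I\<close> that]]
      by (simp add: has_real_derivative_iff_has_vector_derivative)
    then show ?thesis unfolding \<Phi>_def
      by (intro has_vector_derivative_Pair) simp_all
  qed
  have \<Phi>0: "\<Phi> 0 x = monomials2 (g x)" for x
    by (simp add: \<Phi>_def m_def monomials2_def eval_nat_numeral)
  have "\<exists>a. a \<noteq> 0 \<and> (\<forall>j\<le>5. a \<bullet> \<Phi> j s = 0)"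
  proof (rule limit_of_annihilators[where \<Phi> = \<Phi>, OF I_open s \<Phi>d])
    fix \<epsilon> :: real assume "\<epsilon> > 0"
    then obtain F T where F: "quadratic_fun F" and T: "T \<subseteq> ball s \<epsilon>" "card T = 6" "\<forall>x\<in>T. F (g x) = 0"
      using zeros by blast
    obtain a b c d e f where abc: "(a, b, c) \<noteq> (0, 0, 0)"
      "F = (\<lambda>z. a * (z$1)^2 + b * z$1 * z$2 + c * (z$2)^2 + d * z$1 + e * z$2 + f)"
      using F unfolding quadratic_fun_def by blast
    have "(a, b, c, d, e, f) \<noteq> 0" using abc(1) by (auto simp: zero_prod_def)
    moreover have "(a, b, c, d, e, f) \<bullet> \<Phi> 0 x = F (g x)" for x
      by (simp add: \<Phi>0 monomials2_def abc(2) algebra_simps)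
    moreover have "finite T" using T(2) card.infinite by fastforce
    ultimately show "\<exists>a T. a \<noteq> 0 \<and> T \<subseteq> ball s \<epsilon> \<and> finite T \<and> card T = Suc 5 \<and> (\<forall>x\<in>T. a \<bullet> \<Phi> 0 x = 0)"
      using T by (intro exI[of _ "(a, b, c, d, e, f)"] exI[of _ T]) simp
  qed
  then obtain A where A: "A \<noteq> 0" "\<And>j. j \<le> 5 \<Longrightarrow> A \<bullet> \<Phi> j s = 0" by blast
  define F where "F = (\<lambda>z. A \<bullet> monomials2 z)"
  obtain a b c d e f where Aeq: "A = (a, b, c, d, e, f)" by (metis prod_cases6)
  have F: "F = (\<lambda>z. a * (z$1)^2 + b * z$1 * z$2 + c * (z$2)^2 + d * z$1 + e * z$2 + f)"
    by (simp add: F_def Aeq monomials2_def algebra_simps)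
  then have pF: "poly2 F" unfolding poly2_def by blast
  have Fg: "real_analytic_at (\<lambda>x. F (g x)) s"
    using g_analytic s by (intro poly2_real_analytic[OF pF]) (simp add: real_analytic_on_iff)
  have "(deriv ^^ j) (\<lambda>x. F (g x)) s = A \<bullet> \<Phi> j s" for j
  proof -
    have "((\<lambda>x. A \<bullet> \<Phi> j x) has_real_derivative A \<bullet> \<Phi> (Suc j) x) (at x)" if "x \<in> I" for j x
      using bounded_linear.has_vector_derivative[OF bounded_linear_inner_right \<Phi>d[OF that]]
      by (simp add: has_real_derivative_iff_has_vector_derivative)
    from higher_deriv_unique[of I "\<lambda>j x. A \<bullet> \<Phi> j x", OF I_open this s]
    show ?thesis by (simp add: \<Phi>0 F_def)
  qed
  then have z: "(deriv ^^ j) (\<lambda>x. F (g x)) s = 0" if "j \<le> 5" for j using A(2) that by simp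
  have fl: "flat_at 4 C (g s) F" "flat_at 5 C (g s) F"
    unfolding flat_at_param_iff[OF aparam s] real_analytic_flat_iff[OF Fg] using z by auto
  obtain k where k: "F = (\<lambda>z. k * Q (mu s) s z)"
    using flat_4_imp_multiple[OF s pF fl(1)] by blast
  have "k \<noteq> 0"
  proof
    assume "k = 0"
    then have "F z = 0" for z using k by simp
    then have "A = 0" using poly2_coeffs_0[of a b c d e f] by (simp add: F Aeq zero_prod_def)
    then show False using A(1) by blast
  qed
  have "((\<lambda>z. inverse k * (F z / norm (z - g s) ^ 5)) \<longlongrightarrow> inverse k * 0) (at (g s) within C)"
    using fl(2) unfolding flat_at_def by (intro tendsto_intros)
  moreover have "(\<lambda>z. inverse k * (F z / norm (z - g s) ^ 5)) = (\<lambda>z. Q (mu s) s z / norm (z - g s) ^ 5)"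
    using \<open>k \<noteq> 0\<close> by (simp add: k flip: mult.assoc)
  ultimately have "flat_at 5 C (g s) (Q (mu s) s)"
    unfolding flat_at_def by (simp only: mult_zero_right)
  then show ?thesis using Q_flat_5_iff[OF s] by blast
qed

end

subsection \<open>Six zeros near an extremum\<close>

text \<open>Finitely many strict inequalities that hold at a = 0 persist for small positive
  a.\<close>

lemma small_coefficient:
  fixes y :: "nat \<Rightarrow> real"
  assumes "\<And>i. i < n \<Longrightarrow> y i > 0"
  obtains a where "a > 0" "\<And>i. i < n \<Longrightarrow> a * x i < y i"
proof -
  have "eventually (\<lambda>a. a * x i < y i) (at_right 0)" if "i < n" for i
  proof (rule order_tendstoD)
    show "((\<lambda>a. a * x i) \<longlongrightarrow> 0 * x i) (at_right 0)" by (intro tendsto_intros)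
  qed (use assms that in simp)
  then have "eventually (\<lambda>a. \<forall>i\<in>{..<n}. a * x i < y i) (at_right 0)"
    by (intro eventually_ball_finite) auto
  then have "eventually (\<lambda>a. a > 0 \<and> (\<forall>i\<in>{..<n}. a * x i < y i)) (at_right 0)"
    using eventually_at_right_less[of 0] by eventually_elim auto
  from eventually_happens'[OF trivial_limit_at_right_real this]
  obtain a where "a > 0" "\<forall>i\<in>{..<n}. a * x i < y i" by blast
  then show thesis using that by blast
qed

lemma IVT_sign_change:
  fixes f :: "real \<Rightarrow> real"
  assumes "continuous_on {a..b} f" "a < b" "f a * f b < 0"
  shows "\<exists>x. a < x \<and> x < b \<and> f x = 0"
proof -
  have "\<exists>x. a \<le> x \<and> x \<le> b \<and> f x = 0"
    using assms IVT'[of f a 0 b] IVT2'[of f b 0 a] by (auto simp: mult_less_0_iff)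
  then obtain x where "a \<le> x" "x \<le> b" "f x = 0" by blast
  moreover from this have "x \<noteq> a" "x \<noteq> b" using assms(3) by auto
  ultimately show ?thesis by force
qed

text \<open>Subtract \<open>a w\<^sup>2\<close>, add \<open>b w\<close> and subtract \<open>c\<close>, each coefficient much smaller than the
  previous one: every step creates two further sign changes.\<close>

lemma perturbation_six_zeros:
  fixes f w :: "real \<Rightarrow> real"
  assumes \<epsilon>: "\<epsilon> > 0"
    and cont: "continuous_on (ball s \<epsilon>) f" "continuous_on (ball s \<epsilon>) w"
    and f: "\<And>r. r \<in> ball s \<epsilon> \<Longrightarrow> f r \<ge> 0" "f s = 0" "w s = 0"
    and limf: "((\<lambda>r. f r / (r - s) ^ 4) \<longlongrightarrow> 0) (at s)"
    and limw: "((\<lambda>r. w r / (r - s) ^ 2) \<longlongrightarrow> 1 / 2) (at s)"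
  shows "\<exists>a b c T. T \<subseteq> ball s \<epsilon> \<and> card T = 6 \<and> (\<forall>r\<in>T. f r - a * (w r)\<^sup>2 + b * w r - c = 0)"
proof (cases "(\<exists>l. s - \<epsilon> < l \<and> l < s \<and> f l > 0) \<and> (\<exists>r. s < r \<and> r < s + \<epsilon> \<and> f r > 0)")
  \<comment> \<open>If f is positive nowhere on one side of s, it vanishes on that side, and all
    three coefficients can be 0.\<close>
  case False
  then have "(\<forall>x\<in>{s - \<epsilon><..<s}. f x = 0) \<or> (\<forall>x\<in>{s<..<s + \<epsilon>}. f x = 0)"
  proof (cases "\<exists>l. s - \<epsilon> < l \<and> l < s \<and> f l > 0")
    case True
    have "f x = 0" if "x \<in> {s<..<s + \<epsilon>}" for x
      using False True that f(1)[of x] by (force simp: dist_real_def)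
    then show ?thesis by blast
  next
    case no: False
    have "f x = 0" if "x \<in> {s - \<epsilon><..<s}" for x
      using no that f(1)[of x] by (force simp: dist_real_def)
    then show ?thesis by blast
  qed
  moreover have "infinite {s - \<epsilon><..<s}" "infinite {s<..<s + \<epsilon>}" using \<epsilon> by (simp_all add: infinite_Ioo)
  ultimately obtain S where S: "infinite S" "S \<subseteq> ball s \<epsilon>" "\<forall>x\<in>S. f x = 0"
    by (metis ball_eq_greaterThanLessThan greaterThanLessThan_subseteq_greaterThanLessThan
        less_add_same_cancel1 less_imp_le order_refl diff_less_eq)
  then obtain T where "T \<subseteq> S" "card T = 6" using infinite_arbitrarily_large by metis
  then show ?thesis using S by (intro exI[of _ 0] exI[of _ T]) auto
next
  case True
  then obtain l r where lr: "s - \<epsilon> < l" "l < s" "f l > 0" "s < r" "r < s + \<epsilon>" "f r > 0" by blast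
  \<comment> \<open>Small enough to keep f - a w^2 positive at the outer points l and r.\<close>
  obtain a where a: "a > 0" "a * (w l)\<^sup>2 < f l" "a * (w r)\<^sup>2 < f r"
  proof -
    obtain a where a: "a > 0" "\<And>i. i < 2 \<Longrightarrow> a * ([(w l)\<^sup>2, (w r)\<^sup>2] ! i) < [f l, f r] ! i"
      by (rule small_coefficient[of 2 "\<lambda>i. [f l, f r] ! i" "\<lambda>i. [(w l)\<^sup>2, (w r)\<^sup>2] ! i"])
         (use lr(3,6) in \<open>auto simp: less_2_cases_iff\<close>)
    show thesis using that[OF a(1)] a(2)[of 0] a(2)[of 1] by simp
  qed
  \<comment> \<open>Divided by (x - s)^4, f tends to 0 but a w^2 to a / 4, so f - a w^2 is negative
    close to s.\<close>
  have "((\<lambda>x. a * (w x / (x - s) ^ 2)\<^sup>2 - f x / (x - s) ^ 4) \<longlongrightarrow> a * (1/2)\<^sup>2 - 0) (at s)"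
    by (intro tendsto_intros limf limw)
  then have "eventually (\<lambda>x. a * (w x / (x - s) ^ 2)\<^sup>2 - f x / (x - s) ^ 4 > 0) (at s)"
    by (rule order_tendstoD) (use a in simp)
  moreover have "eventually (\<lambda>x. x \<noteq> s) (at s)" by (simp add: eventually_at_filter)
  ultimately have H1: "eventually (\<lambda>x. f x - a * (w x)\<^sup>2 < 0) (at s)"
  proof eventually_elim
    case (elim x)
    have "(a * (w x)\<^sup>2 - f x) / (x - s) ^ 4 > 0"
      using elim by (simp add: power_divide diff_divide_distrib)
    then show ?case using elim(2) by (simp add: zero_less_divide_iff)
  qed
  have wpos: "eventually (\<lambda>x. w x > 0) (at s)"
  proof -
    have "eventually (\<lambda>x. w x / (x - s) ^ 2 > 0) (at s)"
      using limw by (rule order_tendstoD) simp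
    then show ?thesis by eventually_elim (simp add: zero_less_divide_iff)
  qed
  have "isCont w s" using cont(2) \<epsilon> by (simp add: continuous_on_eq_continuous_at)
  then have w0: "(w \<longlongrightarrow> 0) (at s)" using f(3) by (simp add: isCont_def)
  have left: "\<exists>y. x < y \<and> y < s \<and> P y" and right: "\<exists>y. s < y \<and> y < z \<and> P y"
    if "x < s" "s < z" "eventually P (at s)" for x z P
  proof -
    have "eventually P (at_left s)" "eventually P (at_right s)"
      using that(3) by (simp_all add: eventually_at_split)
    then have ev: "eventually (\<lambda>y. y \<in> {x<..<s} \<and> P y) (at_left s)" "eventually (\<lambda>y. y \<in> {s<..<z} \<and> P y) (at_right s)"
      using eventually_at_left_real[OF that(1)] eventually_at_right_real[OF that(2)]
      by (simp_all add: eventually_conj_iff)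
    show "\<exists>y. x < y \<and> y < s \<and> P y" "\<exists>y. s < y \<and> y < z \<and> P y"
      using eventually_happens'[OF trivial_limit_at_left_real ev(1)]
        eventually_happens'[OF trivial_limit_at_right_real ev(2)] by auto
  qed
  obtain l1 where l1: "l < l1" "l1 < s" "f l1 - a * (w l1)\<^sup>2 < 0" using left[OF lr(2,4) H1] by blast
  obtain r1 where r1: "s < r1" "r1 < r" "f r1 - a * (w r1)\<^sup>2 < 0" using right[OF lr(2,4) H1] by blast
  \<comment> \<open>The signs found so far, at l, r, l1 and r1, must survive the addition of b
    w.\<close>
  obtain b where b: "b > 0" "b * (- w l) < f l - a * (w l)\<^sup>2" "b * (- w r) < f r - a * (w r)\<^sup>2"
    "b * w l1 < a * (w l1)\<^sup>2 - f l1" "b * w r1 < a * (w r1)\<^sup>2 - f r1"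
  proof -
    obtain b where b: "b > 0" "\<And>i. i < 4 \<Longrightarrow> b * ([- w l, - w r, w l1, w r1] ! i)
       < [f l - a * (w l)\<^sup>2, f r - a * (w r)\<^sup>2, a * (w l1)\<^sup>2 - f l1, a * (w r1)\<^sup>2 - f r1] ! i"
    proof (rule small_coefficient[of 4 _ "\<lambda>i. [- w l, - w r, w l1, w r1] ! i"])
      fix i :: nat assume "i < 4"
      then have "i = 0 \<or> i = 1 \<or> i = 2 \<or> i = 3" by linarith
      then show "[f l - a * (w l)\<^sup>2, f r - a * (w r)\<^sup>2, a * (w l1)\<^sup>2 - f l1, a * (w r1)\<^sup>2 - f r1] ! i > 0"
        using a l1 r1 by auto
    qed blast
    show thesis
      using that[OF b(1)] b(2)[of 0] b(2)[of 1] b(2)[of 2] b(2)[of 3] by simp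
  qed
  \<comment> \<open>b w - a w^2 = w (b - a w), and w is positive and small close to s.\<close>
  have "((\<lambda>x. b - a * w x) \<longlongrightarrow> b - a * 0) (at s)" by (intro tendsto_intros w0)
  then have "eventually (\<lambda>x. b - a * w x > 0) (at s)"
    by (rule order_tendstoD) (use b in simp)
  moreover have "eventually (\<lambda>x. x \<in> ball s \<epsilon>) (at s)"
    using eventually_at_in_open'[of "ball s \<epsilon>" s] \<epsilon> by simp
  ultimately have H2: "eventually (\<lambda>x. f x - a * (w x)\<^sup>2 + b * w x > 0) (at s)"
    using wpos
  proof eventually_elim
    case (elim x)
    have "w x * (b - a * w x) > 0" using elim by simp
    then show ?case using f(1)[OF elim(2)] by (simp add: algebra_simps power2_eq_square)
  qed
  obtain l2 where l2: "l1 < l2" "l2 < s" "f l2 - a * (w l2)\<^sup>2 + b * w l2 > 0" using left[OF l1(2) r1(1) H2] by blast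
  obtain r2 where r2: "s < r2" "r2 < r1" "f r2 - a * (w r2)\<^sup>2 + b * w r2 > 0" using right[OF l1(2) r1(1) H2] by blast
  \<comment> \<open>Half of the least positive value: subtracting c keeps the four positive signs
    and makes the value at s, so far 0, negative.\<close>
  define c where "c = Min {f l - a * (w l)\<^sup>2 + b * w l, f r - a * (w r)\<^sup>2 + b * w r,
     f l2 - a * (w l2)\<^sup>2 + b * w l2, f r2 - a * (w r2)\<^sup>2 + b * w r2} / 2"
  define H where "H = (\<lambda>x. f x - a * (w x)\<^sup>2 + b * w x - c)"
  have cM: "2 * c > 0" "2 * c \<le> f l - a * (w l)\<^sup>2 + b * w l" "2 * c \<le> f r - a * (w r)\<^sup>2 + b * w r"
     "2 * c \<le> f l2 - a * (w l2)\<^sup>2 + b * w l2" "2 * c \<le> f r2 - a * (w r2)\<^sup>2 + b * w r2"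
    using b l2 r2 by (simp_all add: c_def)
  \<comment> \<open>Seven alternating signs at l < l1 < l2 < s < r2 < r1 < r yield six
    zeros.\<close>
  have sgn: "H l > 0" "H l1 < 0" "H l2 > 0" "H s < 0" "H r2 > 0" "H r1 < 0" "H r > 0"
    using cM b by (simp_all add: H_def f)
  have Hc: "continuous_on {x..y} H" if "l \<le> x" "y \<le> r" for x y
  proof -
    have "{x..y} \<subseteq> ball s \<epsilon>" using that lr by (auto simp: dist_real_def)
    then show ?thesis unfolding H_def
      using cont by (intro continuous_intros) (auto intro: continuous_on_subset)
  qed
  obtain x1 where x1: "l < x1" "x1 < l1" "H x1 = 0"
    using IVT_sign_change[of l l1 H] Hc[of l l1] l1 l2 r1 r2 lr sgn by (auto simp: mult_less_0_iff)
  obtain x2 where x2: "l1 < x2" "x2 < l2" "H x2 = 0"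
    using IVT_sign_change[of l1 l2 H] Hc[of l1 l2] l1 l2 r1 r2 lr sgn by (auto simp: mult_less_0_iff)
  obtain x3 where x3: "l2 < x3" "x3 < s" "H x3 = 0"
    using IVT_sign_change[of l2 s H] Hc[of l2 s] l1 l2 r1 r2 lr sgn by (auto simp: mult_less_0_iff)
  obtain x4 where x4: "s < x4" "x4 < r2" "H x4 = 0"
    using IVT_sign_change[of s r2 H] Hc[of s r2] l1 l2 r1 r2 lr sgn by (auto simp: mult_less_0_iff)
  obtain x5 where x5: "r2 < x5" "x5 < r1" "H x5 = 0"
    using IVT_sign_change[of r2 r1 H] Hc[of r2 r1] l1 l2 r1 r2 lr sgn by (auto simp: mult_less_0_iff)
  obtain x6 where x6: "r1 < x6" "x6 < r" "H x6 = 0"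
    using IVT_sign_change[of r1 r H] Hc[of r1 r] l1 l2 r1 r2 lr sgn by (auto simp: mult_less_0_iff)
  define T where "T = {x1, x2, x3, x4, x5, x6}"
  have "x1 < x2" "x2 < x3" "x3 < x4" "x4 < x5" "x5 < x6"
    using less_trans[OF x1(2) x2(1)] less_trans[OF x2(2) x3(1)] less_trans[OF x3(2) x4(1)]
      less_trans[OF x4(2) x5(1)] less_trans[OF x5(2) x6(1)] by simp_all
  then have "card T = 6" unfolding T_def by simp
  moreover have "T \<subseteq> ball s \<epsilon>"
    using x1 x2 x3 x4 x5 x6 lr l1 l2 r1 r2 by (auto simp: T_def dist_real_def)
  moreover have "\<forall>x\<in>T. f x - a * (w x)\<^sup>2 + b * w x - c = 0"
    using x1 x2 x3 x4 x5 x6 by (auto simp: T_def H_def)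
  ultimately show ?thesis by blast
qed

section \<open>Extrema of the affine curvature\<close>

context affine_arc
begin

text \<open>For r and \<tau> near s, \<open>cross2 (g' r) (g'' \<tau>)\<close> is close to 1. It is
  the derivative of \<open>u \<tau> (g r)\<close> in r, so u has the sign of r - \<tau>; and v, with
  derivative -u in the base point, grows as the base point moves away from r.\<close>

lemma frame_signs:
  assumes s: "s \<in> I"
  obtains \<delta> where "\<delta> > 0" "ball s \<delta> \<subseteq> I"
    "\<And>r \<tau>. r \<in> ball s \<delta> \<Longrightarrow> \<tau> \<in> ball s \<delta> \<Longrightarrow> \<tau> < r \<Longrightarrow> u \<tau> (g r) > 0"
    "\<And>r \<tau>. r \<in> ball s \<delta> \<Longrightarrow> \<tau> \<in> ball s \<delta> \<Longrightarrow> r < \<tau> \<Longrightarrow> u \<tau> (g r) < 0"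
    "\<And>r \<tau>. r \<in> ball s \<delta> \<Longrightarrow> \<tau> \<in> ball s \<delta> \<Longrightarrow> r \<noteq> \<tau> \<Longrightarrow> v \<tau> (g r) > 0"
proof -
  have "isCont g' s" "isCont g'' s"
    by (rule has_vector_derivative_continuous, rule g'_deriv[OF s])
       (rule has_vector_derivative_continuous, rule g''_deriv[OF s])
  then have lim: "(g' \<longlongrightarrow> g' s) (nhds s)" "(g'' \<longlongrightarrow> g'' s) (nhds s)"
    unfolding isCont_def by (simp_all only: tendsto_at_iff_tendsto_nhds[of g' s] tendsto_at_iff_tendsto_nhds[of g'' s])
  \<comment> \<open>The limit is taken in both variables jointly, to get one radius for all
    pairs.\<close>
  have "((\<lambda>x. cross2 (g' (fst x)) (g'' (snd x))) \<longlongrightarrow> cross2 (g' s) (g'' s)) (nhds s \<times>\<^sub>F nhds s)"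
    unfolding cross2_def
    by (intro tendsto_intros filterlim_compose[OF lim(1) filterlim_fst] filterlim_compose[OF lim(2) filterlim_snd])
  then have "eventually (\<lambda>x. cross2 (g' (fst x)) (g'' (snd x)) > 0) (nhds s \<times>\<^sub>F nhds s)"
    by (rule order_tendstoD) (simp add: cross_g'_g''[OF s])
  then obtain P1 P2 where P: "eventually P1 (nhds s)" "eventually P2 (nhds s)"
    "\<And>r \<tau>. P1 r \<Longrightarrow> P2 \<tau> \<Longrightarrow> cross2 (g' r) (g'' \<tau>) > 0"
    by (auto simp: eventually_prod_filter)
  have "eventually (\<lambda>x. x \<in> I) (nhds s)" using I_open s by (rule eventually_nhds_in_open)
  with P(1,2) have "eventually (\<lambda>x. P1 x \<and> P2 x \<and> x \<in> I) (nhds s)" by eventually_elim simp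
  then obtain \<delta> where \<delta>: "\<delta> > 0" "\<And>x. x \<in> ball s \<delta> \<Longrightarrow> P1 x \<and> P2 x \<and> x \<in> I"
    by (auto simp: eventually_nhds_metric dist_commute)
  have conv: "x \<in> ball s \<delta>" if "r \<in> ball s \<delta>" "\<tau> \<in> ball s \<delta>" "r \<le> x" "x \<le> \<tau>" for r \<tau> x
    using that by (auto simp: dist_real_def)
  have du: "((\<lambda>r. u \<tau> (g r)) has_real_derivative cross2 (g' r) (g'' \<tau>)) (at r)" if "r \<in> I" for r \<tau>
  proof -
    have "((\<lambda>r. g r - g \<tau>) has_vector_derivative g' r) (at r)"
      using g_deriv[OF that] by (auto intro!: derivative_eq_intros)
    from cross2_has_derivative[OF this has_vector_derivative_const[of "g'' \<tau>"]]
    show ?thesis unfolding u_def by (simp add: cross2_def)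
  qed
  have up: "u \<tau> (g r) > 0" if r: "r \<in> ball s \<delta>" "\<tau> \<in> ball s \<delta>" "\<tau> < r" for r \<tau>
  proof -
    have "\<exists>z. \<tau> < z \<and> z < r \<and> u \<tau> (g r) - u \<tau> (g \<tau>) = (r - \<tau>) * cross2 (g' z) (g'' \<tau>)"
      using \<delta>(2) conv[OF r(2,1)] by (intro MVT2[OF r(3)] du) auto
    then obtain z where z: "\<tau> < z" "z < r" "u \<tau> (g r) = (r - \<tau>) * cross2 (g' z) (g'' \<tau>)" by auto
    then show ?thesis using P(3)[of z \<tau>] \<delta>(2) conv[OF r(2,1)] r by simp
  qed
  have un: "u \<tau> (g r) < 0" if r: "r \<in> ball s \<delta>" "\<tau> \<in> ball s \<delta>" "r < \<tau>" for r \<tau>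
  proof -
    have "\<exists>z. r < z \<and> z < \<tau> \<and> u \<tau> (g \<tau>) - u \<tau> (g r) = (\<tau> - r) * cross2 (g' z) (g'' \<tau>)"
      using \<delta>(2) conv[OF r(1,2)] by (intro MVT2[OF r(3)] du) auto
    then obtain z where z: "r < z" "z < \<tau>" "- u \<tau> (g r) = (\<tau> - r) * cross2 (g' z) (g'' \<tau>)" by auto
    then have "- u \<tau> (g r) > 0" using P(3)[of z \<tau>] \<delta>(2) conv[OF r(1,2)] r by simp
    then show ?thesis by simp
  qed
  \<comment> \<open>The mean value theorem is applied in the base point, between \<tau> and r; at r
    the value of v is 0.\<close>
  have vp: "v \<tau> (g r) > 0" if r: "r \<in> ball s \<delta>" "\<tau> \<in> ball s \<delta>" "r \<noteq> \<tau>" for r \<tau>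
  proof (cases "\<tau> < r")
    case True
    have "\<exists>z. \<tau> < z \<and> z < r \<and> v r (g r) - v \<tau> (g r) = (r - \<tau>) * (- u z (g r))"
      using \<delta>(2) conv[OF r(2,1)] by (intro MVT2[OF True] v_deriv) auto
    then obtain z where z: "\<tau> < z" "z < r" "v \<tau> (g r) = (r - \<tau>) * u z (g r)" by auto
    then show ?thesis using up[of r z] conv[OF r(2,1)] r True by simp
  next
    case False
    then have lt: "r < \<tau>" using r(3) by simp
    have "\<exists>z. r < z \<and> z < \<tau> \<and> v \<tau> (g r) - v r (g r) = (\<tau> - r) * (- u z (g r))"
      using \<delta>(2) conv[OF r(1,2)] by (intro MVT2[OF lt] v_deriv) auto
    then obtain z where z: "r < z" "z < \<tau>" "v \<tau> (g r) = (\<tau> - r) * (- u z (g r))" by auto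
    then show ?thesis using un[of r z] conv[OF r(1,2)] r lt by (simp add: mult_pos_neg)
  qed
  show thesis using that[OF \<delta>(1) _ up un vp] \<delta>(2) by blast
qed

text \<open>Moving the base point of \<open>Q (mu s)\<close> from \<open>r\<close> to \<open>s\<close> changes its value at \<open>g r\<close> with the sign
  of \<open>mu s - mu\<close>, so that at an extremum of \<open>mu\<close> the curve stays on one side of its osculating conic.\<close>

lemma Q_sign:
  assumes s: "s \<in> I" and ext: "\<And>\<tau>. \<tau> \<in> I \<Longrightarrow> \<sigma> * (mu \<tau> - mu s) \<le> 0"
  obtains \<delta> where "\<delta> > 0" "ball s \<delta> \<subseteq> I" "\<And>r. r \<in> ball s \<delta> \<Longrightarrow> \<sigma> * Q (mu s) s (g r) \<ge> 0"
proof -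
  obtain \<delta> where \<delta>: "\<delta> > 0" "ball s \<delta> \<subseteq> I"
    "\<And>r \<tau>. r \<in> ball s \<delta> \<Longrightarrow> \<tau> \<in> ball s \<delta> \<Longrightarrow> \<tau> < r \<Longrightarrow> u \<tau> (g r) > 0"
    "\<And>r \<tau>. r \<in> ball s \<delta> \<Longrightarrow> \<tau> \<in> ball s \<delta> \<Longrightarrow> r < \<tau> \<Longrightarrow> u \<tau> (g r) < 0"
    "\<And>r \<tau>. r \<in> ball s \<delta> \<Longrightarrow> \<tau> \<in> ball s \<delta> \<Longrightarrow> r \<noteq> \<tau> \<Longrightarrow> v \<tau> (g r) > 0"
    using frame_signs[OF s] by blast
  have conv: "x \<in> ball s \<delta>" if "r \<in> ball s \<delta>" "\<tau> \<in> ball s \<delta>" "r \<le> x" "x \<le> \<tau>" for r \<tau> x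
    using that by (auto simp: dist_real_def)
  have sb: "s \<in> ball s \<delta>" using \<delta>(1) by simp
  have "\<sigma> * Q (mu s) s (g r) \<ge> 0" if r: "r \<in> ball s \<delta>" for r
  proof (cases r s rule: linorder_cases)
    case less
    have "\<exists>z. r < z \<and> z < s \<and> Q (mu s) s (g r) - Q (mu s) r (g r)
       = (s - r) * (2 * (mu z - mu s) * (u z (g r) * v z (g r)))"
      using \<delta>(2) conv[OF r sb] by (intro MVT2[OF less] Q_deriv) auto
    then obtain z where z: "r < z" "z < s"
      "Q (mu s) s (g r) = (s - r) * (2 * (mu z - mu s) * (u z (g r) * v z (g r)))" by auto
    have zb: "z \<in> ball s \<delta>" using conv[OF r sb] z by simp
    have "u z (g r) < 0" "v z (g r) > 0" using \<delta>(4,5)[OF r zb] z by auto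
    then have "2 * (s - r) * (u z (g r) * v z (g r)) \<le> 0"
      using less by (simp add: mult_le_0_iff mult_nonneg_nonpos)
    then have "(\<sigma> * (mu z - mu s)) * (2 * (s - r) * (u z (g r) * v z (g r))) \<ge> 0"
      using ext[of z] zb \<delta>(2) by (meson mult_nonpos_nonpos subsetD)
    then show ?thesis unfolding z(3) by (simp only: mult_ac)
  next
    case equal
    then show ?thesis by simp
  next
    case greater
    have "\<exists>z. s < z \<and> z < r \<and> Q (mu s) r (g r) - Q (mu s) s (g r)
       = (r - s) * (2 * (mu z - mu s) * (u z (g r) * v z (g r)))"
      using \<delta>(2) conv[OF sb r] by (intro MVT2[OF greater] Q_deriv) auto
    then obtain z where z: "s < z" "z < r"
      "- Q (mu s) s (g r) = (r - s) * (2 * (mu z - mu s) * (u z (g r) * v z (g r)))" by auto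
    have zb: "z \<in> ball s \<delta>" using conv[OF sb r] z by simp
    have "u z (g r) > 0" "v z (g r) > 0" using \<delta>(3,5)[OF r zb] z by auto
    then have "2 * (r - s) * (u z (g r) * v z (g r)) \<ge> 0"
      using greater by simp
    then have "(\<sigma> * (mu z - mu s)) * (2 * (r - s) * (u z (g r) * v z (g r))) \<le> 0"
      using ext[of z] zb \<delta>(2) by (meson mult_nonpos_nonneg subsetD)
    then have "\<sigma> * (- Q (mu s) s (g r)) \<le> 0" unfolding z(3) by (simp only: mult_ac)
    then show ?thesis by simp
  qed
  then show thesis using that \<delta>(1,2) by blast
qed

text \<open>The perturbation lemma is used with f = \<sigma> Q and w = v: Q is flat of order four,
  and v behaves like (r - s)^2 / 2.\<close>

lemma extremum_six_zeros:
  assumes s: "s \<in> I" and ext: "\<And>\<tau>. \<tau> \<in> I \<Longrightarrow> \<sigma> * (mu \<tau> - mu s) \<le> 0" and "\<sigma> \<noteq> 0" and "\<epsilon> > 0"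
  shows "\<exists>F T. quadratic_fun F \<and> T \<subseteq> ball s \<epsilon> \<and> card T = 6 \<and> (\<forall>x\<in>T. F (g x) = 0)"
proof -
  obtain \<delta> where \<delta>: "\<delta> > 0" "ball s \<delta> \<subseteq> I" "\<And>r. r \<in> ball s \<delta> \<Longrightarrow> \<sigma> * Q (mu s) s (g r) \<ge> 0"
    using Q_sign[OF s ext] by blast
  define e where "e = min \<delta> \<epsilon>"
  have e: "e > 0" "ball s e \<subseteq> ball s \<delta>" "ball s e \<subseteq> ball s \<epsilon>"
    using \<delta>(1) \<open>\<epsilon> > 0\<close> by (auto simp: e_def)
  have gc: "continuous_on (ball s e) g"
    using g_deriv \<delta>(2) e(2) by (intro continuous_at_imp_continuous_on) (blast intro: has_vector_derivative_continuous)
  have vc: "continuous_on (ball s e) (\<lambda>r. v s (g r))"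
    unfolding v_def cross2_def by (intro continuous_intros gc)
  have uc: "continuous_on (ball s e) (\<lambda>r. u s (g r))"
    unfolding u_def cross2_def by (intro continuous_intros gc)
  have "\<exists>a b c T. T \<subseteq> ball s e \<and> card T = 6 \<and>
    (\<forall>r\<in>T. \<sigma> * Q (mu s) s (g r) - a * (v s (g r))\<^sup>2 + b * v s (g r) - c = 0)"
  proof (rule perturbation_six_zeros[OF e(1)])
    show "continuous_on (ball s e) (\<lambda>r. \<sigma> * Q (mu s) s (g r))"
      unfolding Q_def by (intro continuous_intros uc vc)
    have "((\<lambda>r. \<sigma> * (Q (mu s) s (g r) / (r - s) ^ 4)) \<longlongrightarrow> \<sigma> * 0) (at s)"
      using Q_flat[OF s] unfolding flat_at_param_iff[OF aparam s] by (intro tendsto_intros)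
    then show "((\<lambda>r. \<sigma> * Q (mu s) s (g r) / (r - s) ^ 4) \<longlongrightarrow> 0) (at s)" by simp
  qed (use vc v_tendsto[OF s] \<delta>(3) e(2) in auto)
  then obtain a b c T where T: "T \<subseteq> ball s e" "card T = 6"
    "\<And>r. r \<in> T \<Longrightarrow> \<sigma> * Q (mu s) s (g r) - a * (v s (g r))\<^sup>2 + b * v s (g r) - c = 0" by blast
  \<comment> \<open>Only the coefficients of v^2, v and 1 are perturbed; the coefficient \<sigma> of
    u^2 keeps F quadratic.\<close>
  define F where "F = (\<lambda>z. \<sigma> * (u s z)\<^sup>2 + 0 * u s z * v s z + (\<sigma> * mu s - a) * (v s z)\<^sup>2
     + 0 * u s z + (b - 2 * \<sigma>) * v s z + (- c))"
  have "quadratic_fun F" unfolding F_def by (rule frame_quadratic[OF s \<open>\<sigma> \<noteq> 0\<close>])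
  moreover have "F (g r) = 0" if "r \<in> T" for r
    using T(3)[OF that] by (simp add: F_def Q_def algebra_simps)
  ultimately show ?thesis using T(1,2) e(3) by blast
qed

end

subsection \<open>Strictly convex bodies\<close>

text \<open>Of three collinear points one lies strictly between the other two, hence would be
  interior.\<close>

lemma strictly_convex_no_3_collinear:
  assumes "closed K" "strictly_convex K" "U \<subseteq> frontier K" "card U = 3"
  shows "\<not> collinear U"
proof
  assume "collinear U"
  obtain a b c where U: "U = {a, b, c}" and ne: "a \<noteq> b" "b \<noteq> c" "a \<noteq> c"
    using assms(4) by (auto simp: card_3_iff)
  have no: False if "between (x, y) z" "z \<noteq> x" "z \<noteq> y" "x \<noteq> y" "x \<in> U" "y \<in> U" "z \<in> U" for x y z
  proof -
    have "U \<subseteq> K" using assms(3) frontier_subset_closed[OF assms(1)] by (rule subset_trans)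
    then have "x \<in> K" "y \<in> K" using that(5,6) by auto
    then have "open_segment x y \<subseteq> interior K"
      using assms(2) that(4) unfolding strictly_convex_def by blast
    moreover have "z \<in> open_segment x y"
      using that by (simp add: between_mem_segment open_segment_def)
    ultimately show False using assms(3) that(7) by (auto simp: frontier_def)
  qed
  show False
    using \<open>collinear U\<close> unfolding U collinear_between_cases
    using no[of b c a] no[of c a b] no[of a b c] ne U by auto
qed

lemma strictly_convex_extreme_point_iff:
  fixes K :: "(real^2) set"
  assumes "closed K" "strictly_convex K"
  shows "p extreme_point_of K \<longleftrightarrow> p \<in> frontier K"
proof
  assume "p extreme_point_of K"
  then show "p \<in> frontier K"
    using extreme_point_not_in_interior[of p K] closure_subset[of K]
    by (auto simp: frontier_def extreme_point_of_def)
next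
  assume p: "p \<in> frontier K"
  then have "p \<in> K" "p \<notin> interior K" using assms(1) frontier_subset_closed by (auto simp: frontier_def)
  moreover have "p \<notin> open_segment a b" if "a \<in> K" "b \<in> K" for a b
    using assms(2) that \<open>p \<notin> interior K\<close> unfolding strictly_convex_def
    by (cases "a = b") auto
  ultimately show "p extreme_point_of K" by (simp add: extreme_point_of_def)
qed

lemma connected_frontier_convex:
  fixes K :: "(real^2) set"
  assumes "convex K" "bounded K" "interior K \<noteq> {}"
  shows "connected (frontier K)"
proof -
  have "rel_frontier K = frontier K"
    using rel_frontier_frontier affine_hull_nonempty_interior assms(3) by blast
  \<comment> \<open>Dimension one is the exception: there the relative boundary consists of two
    points.\<close>
  moreover have "aff_dim K \<noteq> 1" using aff_dim_nonempty_interior[OF assms(3)] by simp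
  ultimately show ?thesis using connected_sphere_gen[OF assms(1,2)] by simp
qed

subsection \<open>Conics containing the boundary\<close>

lemma quadratic_three_roots:
  fixes A B C :: real
  assumes "A * x\<^sup>2 + B * x + C = 0" "A * y\<^sup>2 + B * y + C = 0" "A * z\<^sup>2 + B * z + C = 0"
    and ne: "x \<noteq> y" "y \<noteq> z" "x \<noteq> z"
  shows "A = 0 \<and> B = 0 \<and> C = 0"
proof -
  have "(x - y) * (A * (x + y) + B) = 0" using assms(1,2) by (simp add: algebra_simps power2_eq_square)
  then have 1: "A * (x + y) + B = 0" using ne by simp
  have "(x - z) * (A * (x + z) + B) = 0" using assms(1,3) by (simp add: algebra_simps power2_eq_square)
  then have 2: "A * (x + z) + B = 0" using ne by simp
  have "A * (y - z) = (A * (x + y) + B) - (A * (x + z) + B)" by (simp add: algebra_simps)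
  then have "A * (y - z) = 0" using 1 2 by simp
  then have "A = 0" using ne by simp
  then show ?thesis using 1 assms(1) by simp
qed

lemma poly2_three_roots_on_line:
  assumes "poly2 F" "F (p + x *\<^sub>R q) = 0" "F (p + y *\<^sub>R q) = 0" "F (p + z *\<^sub>R q) = 0"
    "x \<noteq> y" "y \<noteq> z" "x \<noteq> z"
  shows "F (p + t *\<^sub>R q) = 0"
proof -
  obtain a b c d e f where F: "F = (\<lambda>z. a * (z$1)^2 + b * z$1 * z$2 + c * (z$2)^2 + d * z$1 + e * z$2 + f)"
    using assms(1) unfolding poly2_def by blast
  define A where "A = a * (q$1)\<^sup>2 + b * q$1 * q$2 + c * (q$2)\<^sup>2"
  define B where "B = 2 * a * p$1 * q$1 + b * (p$1 * q$2 + q$1 * p$2) + 2 * c * p$2 * q$2 + d * q$1 + e * q$2"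
  have line: "F (p + t *\<^sub>R q) = A * t\<^sup>2 + B * t + F p" for t
    by (simp add: F A_def B_def algebra_simps power2_eq_square)
  have "A = 0 \<and> B = 0 \<and> F p = 0"
    using quadratic_three_roots[of A x B "F p" y z] assms(2-7) unfolding line by blast
  then show ?thesis by (simp add: line)
qed

text \<open>Along the line from a point w of S towards z, F already has three zeros near w.\<close>

lemma poly2_zero_on_open:
  assumes F: "poly2 F" and S: "open S" "S \<noteq> {}" "\<And>z. z \<in> S \<Longrightarrow> F z = 0"
  shows "F z = 0"
proof -
  obtain w where w: "w \<in> S" using S(2) by blast
  then obtain e where e: "e > 0" "ball w e \<subseteq> S" using S(1) open_contains_ball by blast
  \<comment> \<open>The summand 1 keeps the denominator positive when z = w.\<close>
  define k where "k = e / (2 * (norm (z - w) + 1))"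
  have n: "norm (z - w) + 1 > 0" by (simp add: add_nonneg_pos)
  then have k: "k > 0" using e(1) by (simp add: k_def)
  have "k * norm (z - w) < e"
  proof -
    have "k * norm (z - w) \<le> k * (norm (z - w) + 1)" using k by simp
    also have "\<dots> = e / 2" using n by (simp add: k_def field_simps)
    finally show ?thesis using e(1) by simp
  qed
  then have "w + k *\<^sub>R (z - w) \<in> S" "w + (- k) *\<^sub>R (z - w) \<in> S"
    using e(2) k by (auto simp: dist_norm abs_mult subset_eq)
  then have "F (w + 1 *\<^sub>R (z - w)) = 0"
    using S(3) w k by (intro poly2_three_roots_on_line[OF F, of w k "z - w" "- k" 0 1]) simp_all
  then show ?thesis by simp
qed

lemma quadratic_fun_not_0:
  assumes "quadratic_fun F"
  shows "\<exists>z. F z \<noteq> 0"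
proof (rule ccontr)
  assume "\<nexists>z. F z \<noteq> 0"
  moreover obtain a b c d e f where "(a, b, c) \<noteq> (0, 0, 0)"
    "F = (\<lambda>z. a * (z$1)^2 + b * z$1 * z$2 + c * (z$2)^2 + d * z$1 + e * z$2 + f)"
    using assms unfolding quadratic_fun_def by blast
  ultimately show False using poly2_coeffs_0[of a b c d e f] by simp
qed

text \<open>A further zero \<open>z\<close> of \<open>F\<close> would give three zeros on every line joining \<open>z\<close> to an interior
  point.\<close>

lemma frontier_eq_conic:
  fixes K :: "(real^2) set"
  assumes "bounded K" "interior K \<noteq> {}" and F: "quadratic_fun F" "\<And>z. z \<in> frontier K \<Longrightarrow> F z = 0"
  shows "frontier K = {z. F z = 0}"
proof (rule ccontr)
  assume "frontier K \<noteq> {z. F z = 0}"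
  then obtain z where z: "F z = 0" "z \<notin> frontier K" using F(2) by blast
  have pF: "poly2 F" by (rule quadratic_fun_imp_poly2[OF F(1)])
  \<comment> \<open>z may itself be interior, and w = z would span no line.\<close>
  have int0: "F w = 0" if w: "w \<in> interior K - {z}" for w
  proof -
    have wK: "w \<in> interior K" and ne: "z - w \<noteq> 0" "w - z \<noteq> 0" using w by auto
    obtain d1 where d1: "d1 > 0" "w + d1 *\<^sub>R (z - w) \<in> frontier K"
      using ray_to_frontier[OF assms(1) wK ne(1)] by blast
    obtain d2 where d2: "d2 > 0" "w + d2 *\<^sub>R (w - z) \<in> frontier K"
      using ray_to_frontier[OF assms(1) wK ne(2)] by blast
    have "w + d2 *\<^sub>R (w - z) = w + (- d2) *\<^sub>R (z - w)" by (simp add: algebra_simps)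
    then have f: "F (w + d1 *\<^sub>R (z - w)) = 0" "F (w + (- d2) *\<^sub>R (z - w)) = 0" "F (w + 1 *\<^sub>R (z - w)) = 0"
      using F(2) d1(2) d2(2) z(1) by auto
    \<comment> \<open>The parameters d1, -d2 and 1 are distinct because z is off the boundary; w has
      parameter 0.\<close>
    have "d1 \<noteq> 1" using d1(2) z(2) by auto
    then have "F (w + 0 *\<^sub>R (z - w)) = 0"
      using d1(1) d2(1) by (intro poly2_three_roots_on_line[OF pF f]) auto
    then show ?thesis by simp
  qed
  have "interior K - {z} \<noteq> {}"
    by (metis assms(2) open_interior not_open_singleton Diff_eq_empty_iff subset_singleton_iff)
  then have "F x = 0" for x
    using poly2_zero_on_open[OF pF _ _ int0] open_interior open_delete by blast
  then show False using quadratic_fun_not_0[OF F(1)] by blast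
qed

text \<open>The largest relatively open set Z of zeros is also relatively closed: if zeros
  accumulated at a point outside Z, the identity theorem would put it into Z, so the points near it
  on the curve are not zeros at all.\<close>

lemma real_analytic_curve_conic_continuation:
  assumes C: "real_analytic_curve C" "connected C" and F: "poly2 F"
    and U: "openin (top_of_set C) U" "U \<noteq> {}" "\<And>z. z \<in> U \<Longrightarrow> F z = 0"
  shows "z \<in> C \<Longrightarrow> F z = 0"
proof -
  define Z where "Z = \<Union>{U. openin (top_of_set C) U \<and> (\<forall>z\<in>U. F z = 0)}"
  have Zo: "openin (top_of_set C) Z" unfolding Z_def by (rule openin_Union) blast
  have "openin (top_of_set C) (C - Z)"
  proof (subst openin_subopen, intro ballI)
    fix p assume p: "p \<in> C - Z"
    then obtain I g s where g: "analytic_param C I g" "s \<in> I" "g s = p"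
      using C(1) unfolding real_analytic_curve_def by (metis DiffD1 imageE)
    have Io: "open I" using analytic_paramD(1)[OF g(1)] .
    have an: "real_analytic_at (\<lambda>x. F (g x)) s"
      using analytic_paramD(3)[OF g(1)] g(2) by (intro poly2_real_analytic[OF F]) (simp add: real_analytic_on_iff)
    have "\<not> frequently (\<lambda>x. F (g x) = 0) (at s)"
    proof
      assume "frequently (\<lambda>x. F (g x) = 0) (at s)"
      from real_analytic_at_frequently_0[OF an this]
      have "eventually (\<lambda>x. F (g x) = 0 \<and> x \<in> I) (nhds s)"
        using eventually_nhds_in_open[OF Io g(2)] by eventually_elim simp
      then obtain V where V: "open V" "s \<in> V" "\<And>x. x \<in> V \<Longrightarrow> F (g x) = 0 \<and> x \<in> I"
        by (auto simp: eventually_nhds)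
      then have "openin (top_of_set C) (g ` V)"
        by (intro analytic_param_image_open[OF g(1)]) auto
      then have "p \<in> Z" unfolding Z_def using V g(3) by blast
      then show False using p by blast
    qed
    then have "eventually (\<lambda>x. F (g x) \<noteq> 0) (at s)" by (simp add: frequently_def)
    then have "eventually (\<lambda>x. (x \<noteq> s \<longrightarrow> F (g x) \<noteq> 0) \<and> x \<in> I) (nhds s)"
      using eventually_nhds_in_open[OF Io g(2)] unfolding eventually_at_filter by eventually_elim simp
    then obtain V where V: "open V" "s \<in> V" "\<And>x. x \<in> V \<Longrightarrow> (x \<noteq> s \<longrightarrow> F (g x) \<noteq> 0) \<and> x \<in> I"
      by (auto simp: eventually_nhds)
    have op: "openin (top_of_set C) (g ` V)"
      using V by (intro analytic_param_image_open[OF g(1)]) auto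
    have "g x \<notin> Z" if "x \<in> V" for x
    proof (cases "x = s")
      case False
      then show ?thesis using V(3)[OF that] unfolding Z_def by blast
    qed (use p g(3) in blast)
    then have "g ` V \<subseteq> C - Z" using openin_imp_subset[OF op] by blast
    then show "\<exists>T. openin (top_of_set C) T \<and> p \<in> T \<and> T \<subseteq> C - Z"
      using op V(2) g(3) by blast
  qed
  then have "closedin (top_of_set C) Z"
    using Zo openin_imp_subset by (auto simp: closedin_def)
  moreover have "Z \<noteq> {}" using U unfolding Z_def by blast
  ultimately have "Z = C" using C(2) Zo unfolding connected_clopen by blast
  then show "z \<in> C \<Longrightarrow> F z = 0" unfolding Z_def by blast
qed

section \<open>Cluster points and zeros of mu' along an arc\<close>

context affine_arc
begin

lemma deriv_mu_zero_imp_conic: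
  assumes s: "s \<in> I" and fr: "frequently (\<lambda>x. deriv mu x = 0) (at s)"
  shows "\<exists>F U. quadratic_fun F \<and> openin (top_of_set C) U \<and> U \<noteq> {} \<and> (\<forall>z\<in>U. F z = 0)"
proof -
  have "eventually (\<lambda>x. deriv mu x = 0) (nhds s)"
    by (rule real_analytic_at_frequently_0[OF real_analytic_at_deriv[OF mu_analytic[OF s]] fr])
  then have "eventually (\<lambda>x. deriv mu x = 0 \<and> x \<in> I) (nhds s)"
    using eventually_nhds_in_open[OF I_open s] by eventually_elim simp
  then obtain \<delta> where \<delta>: "\<delta> > 0" "\<And>x. x \<in> ball s \<delta> \<Longrightarrow> deriv mu x = 0 \<and> x \<in> I"
    by (auto simp: eventually_nhds_metric dist_commute)
  have "Q (mu s) s (g r) = 0" if r: "r \<in> ball s \<delta>" for r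
  proof -
    \<comment> \<open>The point \<open>g r\<close> is fixed while the base point runs; at base point
      r the value is 0.\<close>
    have "((\<lambda>\<tau>. Q (mu \<tau>) \<tau> (g r)) has_real_derivative 0) (at x within ball s \<delta>)" if "x \<in> ball s \<delta>" for x
      using Q_mu_deriv[of x "g r"] \<delta>(2)[OF that] by (auto intro: has_field_derivative_at_within)
    then have "\<exists>c. \<forall>x\<in>ball s \<delta>. Q (mu x) x (g r) = c"
      by (intro has_field_derivative_zero_constant) auto
    then have "Q (mu s) s (g r) = Q (mu r) r (g r)"
      using r \<delta>(1) by (metis centre_in_ball)
    then show ?thesis by simp
  qed
  moreover have "openin (top_of_set C) (g ` ball s \<delta>)"
    using \<delta>(2) by (intro analytic_param_image_open[OF aparam]) auto
  ultimately show ?thesis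
    using Q_quadratic[OF s] \<delta>(1) by (intro exI[of _ "Q (mu s) s"] exI[of _ "g ` ball s \<delta>"]) auto
qed

text \<open>The image of a small parameter ball is an open boundary arc, and its six points on a
  conic pull back to six parameters near s.\<close>

lemma conic_cluster_imp_deriv_mu:
  assumes C: "C = frontier K" and s: "s \<in> I" and p: "g s \<in> conic_cluster_set K"
  shows "deriv mu s = 0"
proof (rule six_zeros_imp_deriv_mu[OF s])
  fix \<epsilon> :: real assume "\<epsilon> > 0"
  obtain r where r: "r > 0" "ball s r \<subseteq> I" using I_open s open_contains_ball by blast
  define e where "e = min r \<epsilon>"
  have e: "e > 0" "ball s e \<subseteq> I" "ball s e \<subseteq> ball s \<epsilon>"
    using r \<open>\<epsilon> > 0\<close> by (auto simp: e_def)
  have op: "openin (top_of_set C) (g ` ball s e)"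
    by (rule analytic_param_image_open[OF aparam open_ball e(2)])
  obtain h where h: "homeomorphism I (g ` I) g h" using analytic_paramD(6)[OF aparam] by blast
  have "homeomorphism (ball s e) (g ` ball s e) g h"
    by (rule homeomorphism_of_subsets[OF h]) (use e(2) in auto)
  then have "g ` ball s e homeomorphic ball s e"
    using homeomorphic_def homeomorphic_sym by blast
  also have "ball s e homeomorphic ball (1/2::real) (1/2)"
    using e(1) by (intro homeomorphic_balls) auto
  also have "ball (1/2::real) (1/2) = {0<..<1}" by (simp add: ball_eq_greaterThanLessThan)
  finally have "open_boundary_arc K (g ` ball s e)"
    unfolding open_boundary_arc_def using op C by simp
  moreover have "g s \<in> g ` ball s e" using e(1) by simp
  ultimately obtain T D where T: "T \<subseteq> g ` ball s e" "card T = 6" "is_conic D" "T \<subseteq> D"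
    using p unfolding conic_cluster_set_def by blast
  obtain F where F: "quadratic_fun F" "D = {z. F z = 0}" using T(3) unfolding is_conic_def by blast
  obtain S where S: "S \<subseteq> ball s e" "inj_on g S" "T = g ` S" using T(1) unfolding subset_image_inj by blast
  then have "card S = 6" using T(2) card_image by metis
  then show "\<exists>F T. quadratic_fun F \<and> T \<subseteq> ball s \<epsilon> \<and> card T = 6 \<and> (\<forall>x\<in>T. F (g x) = 0)"
    using F S e(3) T(4) by (intro exI[of _ F] exI[of _ S]) auto
qed

text \<open>\<sigma> = 1 treats a maximum and \<sigma> = -1 a minimum. Every arc around
  \<open>g s\<close> contains the image of a small parameter ball, in which the six zeros are
  found.\<close>

lemma extremum_imp_conic_cluster:
  assumes C: "C = frontier K" and ext: "\<And>p. p \<in> C \<Longrightarrow> p extreme_point_of K" and s: "s \<in> I"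
    and "\<sigma> \<noteq> 0" "\<And>\<tau>. \<tau> \<in> I \<Longrightarrow> \<sigma> * (mu \<tau> - mu s) \<le> 0"
  shows "g s \<in> conic_cluster_set K"
  unfolding conic_cluster_set_def
proof (intro CollectI conjI allI impI)
  show "g s extreme_point_of K" using ext image_subset s by blast
next
  fix A assume A: "open_boundary_arc K A \<and> g s \<in> A"
  then obtain W where W: "open W" "A = C \<inter> W"
    unfolding open_boundary_arc_def C by (auto simp: openin_open)
  have "isCont g s" using has_vector_derivative_continuous[OF g_deriv[OF s]] .
  then have "eventually (\<lambda>x. g x \<in> W) (at s)"
    unfolding isCont_def by (rule topological_tendstoD) (use W A in auto)
  then have "eventually (\<lambda>x. g x \<in> W \<and> x \<in> I) (nhds s)"
    using eventually_nhds_in_open[OF I_open s] unfolding eventually_at_filter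
    by eventually_elim (use W A in \<open>metis IntD2 UNIV_I\<close>)
  then obtain \<epsilon> where \<epsilon>: "\<epsilon> > 0" "\<And>x. x \<in> ball s \<epsilon> \<Longrightarrow> g x \<in> W \<and> x \<in> I"
    by (auto simp: eventually_nhds_metric dist_commute)
  obtain F T where F: "quadratic_fun F" "T \<subseteq> ball s \<epsilon>" "card T = 6" "\<And>x. x \<in> T \<Longrightarrow> F (g x) = 0"
    using extremum_six_zeros[OF s assms(5,4) \<epsilon>(1)] by blast
  obtain h where "homeomorphism I (g ` I) g h" using analytic_paramD(6)[OF aparam] by blast
  then have "inj_on g I" by (metis homeomorphism_apply1 inj_on_inverseI)
  then have "inj_on g T" using F(2) \<epsilon>(2) by (meson inj_on_subset subset_iff)
  then have "card (g ` T) = 6" using F(3) by (simp add: card_image)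
  moreover have "g ` T \<subseteq> A" using F(2) \<epsilon>(2) image_subset W(2) by blast
  moreover have "is_conic {z. F z = 0}" using F(1) unfolding is_conic_def by blast
  moreover have "g ` T \<subseteq> {z. F z = 0}" using F(4) by auto
  moreover have "A \<subseteq> C" using W(2) by blast
  ultimately show "\<exists>T. T \<subseteq> A \<and> card T = 6 \<and> (\<forall>q\<in>T. q extreme_point_of K) \<and> (\<exists>C. is_conic C \<and> T \<subseteq> C)"
    using ext by (intro exI[of _ "g ` T"]) blast
qed

text \<open>The continuous local inverse of g carries accumulation on the curve back to the
  parameter line.\<close>

lemma frequently_deriv_mu_zero:
  assumes s: "s \<in> I" and S: "S \<subseteq> C" "g s islimpt S" "\<And>x. x \<in> I \<Longrightarrow> g x \<in> S \<Longrightarrow> deriv mu x = 0"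
  shows "frequently (\<lambda>x. deriv mu x = 0) (at s)"
  unfolding frequently_def
proof
  assume ev: "eventually (\<lambda>x. deriv mu x \<noteq> 0) (at s)"
  obtain h where h: "filterlim h (at s) (at (g s) within C)"
    "eventually (\<lambda>z. g (h z) = z) (at (g s) within C)"
    using analytic_param_filterlim(2)[OF aparam s] by blast
  have "eventually (\<lambda>x. deriv mu x \<noteq> 0 \<and> x \<in> I) (at s)"
    using ev eventually_at_in_open'[OF I_open s] by eventually_elim simp
  from eventually_compose_filterlim[OF this h(1)] h(2)
  have "eventually (\<lambda>z. z \<notin> S) (at (g s) within C)"
    by eventually_elim (use S(3) in metis)
  then have "eventually (\<lambda>z. z \<notin> S) (at (g s))"
    using S(1) by (auto simp: eventually_at_filter elim!: eventually_mono)
  then show False using S(2) by (simp add: islimpt_iff_eventually)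
qed

end

theorem proposition9p38:
  fixes K :: "(real^2) set"
  assumes "compact K" and "convex K" and "interior K \<noteq> {}"
    and "real_analytic_curve (frontier K)"
    and "strictly_convex K"
    and "positively_curved (frontier K)"
  shows "(\<not> is_conic (frontier K) \<longrightarrow>
            conic_cluster_set K \<subseteq> sextactic_locus K \<and>
            finite (conic_cluster_set K) \<and>
            (\<forall>T \<subseteq> conic_cluster_set K. card T = 4 \<longrightarrow> general_position T)) \<and>
         (\<forall>p. affine_curvature_global_max (frontier K) p \<or>
              affine_curvature_global_min (frontier K) p \<longrightarrow> p \<in> conic_cluster_set K) \<and>
         conic_cluster_set K \<noteq> {} \<and>
         (is_conic (frontier K) \<longrightarrow> conic_cluster_set K = frontier K)"
proof (intro conjI impI allI)
  let ?C = "frontier K"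
  have bounded: "bounded K" and closed: "closed K"
    using assms(1) by (simp_all add: compact_imp_bounded compact_imp_closed)
  have ext: "p extreme_point_of K \<longleftrightarrow> p \<in> ?C" for p
    by (rule strictly_convex_extreme_point_iff[OF closed assms(5)])
  have sub: "conic_cluster_set K \<subseteq> ?C"
    unfolding conic_cluster_set_def using ext by blast
  have arc: "\<exists>I g s. affine_arc ?C I g \<and> s \<in> I \<and> g s = p" if "p \<in> ?C" for p
    using positively_curved_affine_arclength[OF assms(4,6) that] affine_arc.intro by metis
  show "conic_cluster_set K \<subseteq> sextactic_locus K"
  proof
    fix p assume p: "p \<in> conic_cluster_set K"
    then obtain I g s where g: "affine_arc ?C I g" "s \<in> I" "g s = p" using sub arc by blast
    interpret affine_arc ?C I g by (rule g(1))
    show "p \<in> sextactic_locus K"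
      using conic_cluster_imp_deriv_mu[OF refl g(2)] sextactic_iff[OF g(2)] p sub g(3)
      unfolding sextactic_locus_def by blast
  qed
  show "finite (conic_cluster_set K)" if nc: "\<not> is_conic ?C"
  proof (rule ccontr)
    assume "infinite (conic_cluster_set K)"
    moreover have "compact ?C" using assms(1) by (rule compact_frontier)
    \<comment> \<open>Compactness yields a limit point on the boundary; whether it is itself a
      cluster point does not matter for the accumulation of zeros of mu'.\<close>
    ultimately obtain p where p: "p \<in> ?C" "p islimpt conic_cluster_set K"
      using sub unfolding compact_eq_Bolzano_Weierstrass by blast
    obtain I g s where g: "affine_arc ?C I g" "s \<in> I" "g s = p" using arc[OF p(1)] by blast
    interpret affine_arc ?C I g by (rule g(1))
    have "frequently (\<lambda>x. deriv mu x = 0) (at s)"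
      using frequently_deriv_mu_zero[OF g(2) sub] p(2) g(3) conic_cluster_imp_deriv_mu[OF refl] by simp
    then obtain F U where F: "quadratic_fun F" "openin (top_of_set ?C) U" "U \<noteq> {}" "\<And>z. z \<in> U \<Longrightarrow> F z = 0"
      using deriv_mu_zero_imp_conic[OF g(2)] by blast
    have "F z = 0" if "z \<in> ?C" for z
      using real_analytic_curve_conic_continuation[OF assms(4) connected_frontier_convex[OF assms(2) bounded assms(3)]
          quadratic_fun_imp_poly2[OF F(1)] F(2-4)] that by blast
    then have "?C = {z. F z = 0}" by (rule frontier_eq_conic[OF bounded assms(3) F(1)])
    then show False using nc F(1) unfolding is_conic_def by blast
  qed
  show "general_position T" if "T \<subseteq> conic_cluster_set K" for T
    unfolding general_position_def
    using strictly_convex_no_3_collinear[OF closed assms(5)] that sub by blast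
  show ext_cluster: "p \<in> conic_cluster_set K"
    if p: "affine_curvature_global_max ?C p \<or> affine_curvature_global_min ?C p" for p
  proof -
    have pC: "p \<in> ?C"
      using p unfolding affine_curvature_global_max_def affine_curvature_global_min_def by blast
    then obtain I g s where g: "affine_arc ?C I g" "s \<in> I" "g s = p" using arc by blast
    interpret affine_arc ?C I g by (rule g(1))
    have m: "affine_curvature ?C (g \<tau>) = mu \<tau>" "g \<tau> \<in> ?C" if "\<tau> \<in> I" for \<tau>
      using affine_curvature_eq_mu[OF that] image_subset that by auto
    have "(\<forall>\<tau>\<in>I. mu \<tau> \<le> mu s) \<or> (\<forall>\<tau>\<in>I. mu s \<le> mu \<tau>)"
      using p m g(2,3) unfolding affine_curvature_global_max_def affine_curvature_global_min_def by metis
    then have "(\<forall>\<tau>\<in>I. 1 * (mu \<tau> - mu s) \<le> 0) \<or> (\<forall>\<tau>\<in>I. (-1) * (mu \<tau> - mu s) \<le> 0)" by auto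
    then obtain \<sigma> where "\<sigma> \<noteq> 0" "\<And>\<tau>. \<tau> \<in> I \<Longrightarrow> \<sigma> * (mu \<tau> - mu s) \<le> 0"
      by (metis one_neq_zero zero_neq_neg_one)
    then show ?thesis using extremum_imp_conic_cluster[OF refl _ g(2)] ext g(3) by blast
  qed
  have Cne: "?C \<noteq> {}"
    using frontier_eq_empty[of K] assms(3) bounded by (metis interior_empty not_bounded_UNIV)
  show "conic_cluster_set K \<noteq> {}"
  proof -
    obtain p where "p \<in> ?C" "\<forall>q\<in>?C. affine_curvature ?C q \<le> affine_curvature ?C p"
      using continuous_attains_sup[OF compact_frontier[OF assms(1)] Cne continuous_on_affine_curvature[OF assms(4,6)]]
      by blast
    then have "affine_curvature_global_max ?C p" unfolding affine_curvature_global_max_def by blast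
    then show ?thesis using ext_cluster by blast
  qed
  show "conic_cluster_set K = ?C" if conic: "is_conic ?C"
  proof
    show "?C \<subseteq> conic_cluster_set K"
    proof
      fix p assume p: "p \<in> ?C"
      \<comment> \<open>An arc is infinite, and any six of its points lie on the conic that is the
        boundary itself.\<close>
      have "\<exists>T. T \<subseteq> A \<and> card T = 6 \<and> (\<forall>q\<in>T. q extreme_point_of K) \<and> (\<exists>D. is_conic D \<and> T \<subseteq> D)"
        if A: "open_boundary_arc K A" for A
      proof -
        have AC: "A \<subseteq> ?C" using A openin_imp_subset unfolding open_boundary_arc_def by blast
        obtain f k where "homeomorphism A {0<..<1::real} f k"
          using A unfolding open_boundary_arc_def homeomorphic_def by blast
        then have "f ` A = {0<..<1}" by (simp add: homeomorphism_def)
        then have "infinite A" using infinite_Ioo[of 0 "1::real"] by (metis finite_imageI zero_less_one)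
        then obtain T where "T \<subseteq> A" "card T = 6" by (metis infinite_arbitrarily_large)
        then show ?thesis using AC conic ext by (intro exI[of _ T]) blast
      qed
      then show "p \<in> conic_cluster_set K"
        unfolding conic_cluster_set_def using p ext by blast
    qed
  qed (rule sub)
qed

end
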